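(* Let $\alpha\in\mathbb{C}$, $\theta\in\mathbb{R}$, and let $p$ be a positive integer. The shifted convolution quadrature (SCQ) with shift $\theta$ and convolution weights generated by $$\omega(\xi)=(1-\xi)^{-\alpha}\big[\gamma_0+\gamma_1(1-\xi)+\cdots+\gamma_{p-1}(1-\xi)^{p-1}\big],$$ where the $\gamma_i$ are the coefficients of $$\sum_{i=0}^{\infty}\gamma_i(1-\xi)^i=\xi^{\theta}\left(\frac{-\ln\xi}{1-\xi}\right)^{-\alpha},$$ is convergent of order $p$ to $I^{\alpha}$.
   Context: Riemann-Liouville operators: for $\Re\alpha>0$, $I^{\alpha}f(x)=\frac{1}{\Gamma(\alpha)}\int_0^x (x-s)^{\alpha-1}f(s)\,ds$; $I^{-\alpha}f(x)=\frac{d^n}{dx^n}I^{n-\alpha}f(x)$ with $n=\lceil\Re\alpha\rceil$; $I^0$ is the identity. On powers, for $\beta\in\mathbb{C}$, $\beta\neq 0,-1,-2,\dots$, $(I^{\alpha}t^{\beta-1})(x)=\frac{\Gamma(\beta)}{\Gamma(\alpha+\beta)}x^{\alpha+\beta-1}$ (understood by analytic continuation in $\beta$ where the integral diverges, with $1/\Gamma=0$ at the poles of $\Gamma$). SCQ: for a step size $h>0$, weights $\omega_j\in\mathbb{C}$ with generating function $\omega(\xi)=\sum_{j\ge0}\omega_j\xi^j$, and shift $\theta$, the convolution part is $$\Omega_h^{\alpha}f(x)=h^{\alpha}\sum_{0\le jh\le x+\theta h}\omega_j f\big(x+(\theta-j)h\big),$$ and the convolution error is $E_h^{\alpha}=\Omega_h^{\alpha}-I^{\alpha}$;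 $(E_h^{\alpha}t^{\beta-1})(x)$ denotes $E_h^\alpha$ applied to $t\mapsto t^{\beta-1}$ evaluated at $x$. If $\Re\beta<1$, a term in which $t^{\beta-1}$ would be evaluated at $t=0$ is read as $0$. Convergent of order $p$ to $I^{\alpha}$: $(E_h^{\alpha}t^{\beta-1})(1)=O(h^{\beta})+O(h^p)$ as $h\to 0^+$, for all $\beta\in\mathbb{C}$ with $\beta\ne0,-1,-2,\dots$ (the implied constants may depend on $\beta$). Principal branches are used: the functions of $\xi$ are expanded about $\xi=1$, and $(1-\xi)^{-\alpha}$ is the power series in $\xi$ with constant term $1$.
   Formalization: For Re β < 1, h→0+ runs only over steps with no node 1+(θ−j)h strictly between 0 and δh, for any fixed δ>0 (constants may depend on δ; all h=1/N are covered for suitable δ); over all real h the bound fails, e.g. α=1, θ=0, p=1, β=1/2. *)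

theory Defs
  imports
    "HOL-Complex_Analysis.Complex_Analysis"
    "HOL-Library.Landau_Symbols"
begin

text \<open>
  The power function \<open>t\<^sup>\<beta>\<^sup>-\<^sup>1\<close> on \<open>t \<ge> 0\<close>. At \<open>t = 0\<close> it is \<open>1\<close> for \<open>\<beta> = 1\<close> (constant function),
  whereas the library has \<open>0 powr 0 = 0\<close>. For all other \<open>\<beta>\<close> the value at \<open>0\<close> is \<open>0\<close>: this is the
  ordinary value if \<open>Re \<beta> > 1\<close> and the convention for singular terms if \<open>Re \<beta> < 1\<close>; on the line
  \<open>Re \<beta> = 1\<close> it is extended to the remaining, undefined, values \<open>0 powr (\<i> y)\<close>.
\<close>
definition pow_fun :: "complex \<Rightarrow> real \<Rightarrow> complex" where
  "pow_fun \<beta> t = (if \<beta> = 1 then 1 else complex_of_real t powr (\<beta> - 1))"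

definition RL_integral :: "complex \<Rightarrow> (real \<Rightarrow> complex) \<Rightarrow> real \<Rightarrow> complex" where
  "RL_integral \<alpha> f x =
     1 / Gamma \<alpha> * integral {0..x} (\<lambda>s. complex_of_real (x - s) powr (\<alpha> - 1) * f s)"

text \<open>
  The Riemann-Liouville operator of arbitrary order: the \<open>n\<close>-th derivative of \<open>I\<^sup>n\<^sup>+\<^sup>\<alpha>\<close>, where \<open>n\<close> is
  the least natural number such that \<open>I\<^sup>n\<^sup>+\<^sup>\<alpha>\<close> is the identity or an integral. So \<open>n = 0\<close> if
  \<open>Re \<alpha> > 0\<close> or \<open>\<alpha> = 0\<close>, and \<open>n = \<lceil>Re (-\<alpha>)\<rceil>\<close> if \<open>Re \<alpha> < 0\<close>, except that \<open>n\<close> is one larger when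
  \<open>\<lceil>Re (-\<alpha>)\<rceil> + \<alpha>\<close> is a nonzero purely imaginary number, for which the integral would diverge.
\<close>
definition RL_shift :: "complex \<Rightarrow> nat" where
  "RL_shift \<alpha> = (LEAST n. of_nat n + \<alpha> = 0 \<or> Re (of_nat n + \<alpha>) > 0)"

definition RL :: "complex \<Rightarrow> (real \<Rightarrow> complex) \<Rightarrow> real \<Rightarrow> complex" where
  "RL \<alpha> f =
     (let n = RL_shift \<alpha>; a = of_nat n + \<alpha>;
          g = (if a = 0 then f else RL_integral a f)
      in ((\<lambda>u x. vector_derivative u (at x)) ^^ n) g)"

text \<open>
  \<open>I\<^sup>\<alpha>\<close> on the power \<open>t\<^sup>\<beta>\<^sup>-\<^sup>1\<close>, for \<open>\<beta> \<noteq> 0, -1, -2, \<dots>\<close>. For \<open>Re \<beta> \<le> 0\<close> the integral diverges, and the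
  analytic continuation in \<open>\<beta>\<close> is taken; \<open>rGamma\<close> is the entire function \<open>1/\<Gamma>\<close>.
\<close>
definition RL_power :: "complex \<Rightarrow> complex \<Rightarrow> real \<Rightarrow> complex" where
  "RL_power \<alpha> \<beta> x =
     (if Re \<beta> > 0 then RL \<alpha> (pow_fun \<beta>) x
      else Gamma \<beta> * rGamma (\<alpha> + \<beta>) * complex_of_real x powr (\<alpha> + \<beta> - 1))"

definition SCQ ::
  "(nat \<Rightarrow> complex) \<Rightarrow> complex \<Rightarrow> real \<Rightarrow> real \<Rightarrow> (real \<Rightarrow> complex) \<Rightarrow> real \<Rightarrow> complex" where
  "SCQ \<omega> \<alpha> \<theta> h f x =
     complex_of_real h powr \<alpha> *
     (\<Sum>j | 0 \<le> real j * h \<and> real j * h \<le> x + \<theta> * h. \<omega> j * f (x + (\<theta> - real j) * h))"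

definition SCQ_error_power ::
  "(nat \<Rightarrow> complex) \<Rightarrow> complex \<Rightarrow> real \<Rightarrow> real \<Rightarrow> complex \<Rightarrow> real \<Rightarrow> complex" where
  "SCQ_error_power \<omega> \<alpha> \<theta> h \<beta> x = SCQ \<omega> \<alpha> \<theta> h (pow_fun \<beta>) x - RL_power \<alpha> \<beta> x"

text \<open>
  Step sizes used for testing convergence at \<open>x = 1\<close>. If \<open>Re \<beta> \<ge> 1\<close>, all \<open>h > 0\<close> are used. If
  \<open>Re \<beta> < 1\<close>, then \<open>t\<^sup>\<beta>\<^sup>-\<^sup>1\<close> is unbounded at \<open>0\<close>, and a node \<open>1 + (\<theta> - j) h\<close> that is positive but
  arbitrarily small relative to \<open>h\<close> makes the sum arbitrarily large: for \<open>\<alpha> = 1\<close>, \<open>\<theta> = 0\<close>, \<open>p = 1\<close>,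
  all weights are \<open>1\<close>, and \<open>1/h = N + \<tau>\<close> gives the term \<open>h (\<tau> h)\<^sup>\<beta>\<^sup>-\<^sup>1\<close>, which is not \<open>O(h\<^sup>\<beta>)\<close> as
  \<open>\<tau> \<rightarrow> 0\<close>. Hence no node may lie strictly between \<open>0\<close> and \<open>\<delta> h\<close>, where \<open>\<delta> > 0\<close> is arbitrary but
  fixed as \<open>h \<rightarrow> 0\<close>. A node equal to \<open>0\<close> is allowed. For suitable \<open>\<delta>\<close> this contains all step
  sizes \<open>1/N\<close>, for which \<open>1\<close> is a grid point (see \<open>inverse_nat_in_SCQ_steps\<close>).
\<close>
definition SCQ_steps :: "real \<Rightarrow> complex \<Rightarrow> real \<Rightarrow> real set" where
  "SCQ_steps \<theta> \<beta> \<delta> =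
     {h. 0 < h \<and> (Re \<beta> \<ge> 1 \<or>
       (\<forall>j::nat. \<not> (0 < 1 + (\<theta> - real j) * h \<and> 1 + (\<theta> - real j) * h < \<delta> * h)))}"

definition SCQ_convergent_of_order ::
  "(nat \<Rightarrow> complex) \<Rightarrow> complex \<Rightarrow> real \<Rightarrow> nat \<Rightarrow> bool" where
  "SCQ_convergent_of_order \<omega> \<alpha> \<theta> p \<longleftrightarrow>
     (\<forall>\<beta>. \<beta> \<notin> \<int>\<^sub>\<le>\<^sub>0 \<longrightarrow> (\<forall>\<delta>>0.
        let F = at 0 within SCQ_steps \<theta> \<beta> \<delta> in
        \<exists>e1 e2. e1 \<in> O[F](\<lambda>h. complex_of_real h powr \<beta>) \<and>
                e2 \<in> O[F](\<lambda>h. complex_of_real h ^ p) \<and>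
                (\<forall>h\<in>SCQ_steps \<theta> \<beta> \<delta>. SCQ_error_power \<omega> \<alpha> \<theta> h \<beta> 1 = e1 h + e2 h)))"

text \<open>
  \<open>\<gamma>\<^sub>i\<close> is the coefficient of \<open>u\<^sup>i\<close>, where \<open>u = 1 - \<xi>\<close>. The value \<open>1\<close> at \<open>\<xi> = 1\<close> removes the
  singularity of \<open>-ln \<xi> / (1 - \<xi>)\<close>.
\<close>
definition SCQ_symbol :: "complex \<Rightarrow> real \<Rightarrow> complex \<Rightarrow> complex" where
  "SCQ_symbol \<alpha> \<theta> \<xi> =
     (if \<xi> = 1 then 1
      else \<xi> powr complex_of_real \<theta> * (- ln \<xi> / (1 - \<xi>)) powr (- \<alpha>))"

definition SCQ_gamma :: "complex \<Rightarrow> real \<Rightarrow> nat \<Rightarrow> complex" where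
  "SCQ_gamma \<alpha> \<theta> i = fps_nth (fps_expansion (\<lambda>u. SCQ_symbol \<alpha> \<theta> (1 - u)) 0) i"

text \<open>The series \<open>(1 - \<xi>)\<^sup>-\<^sup>\<alpha>\<close> is the binomial series \<open>(1 + X)\<^sup>-\<^sup>\<alpha>\<close> at \<open>X = -\<xi>\<close>.\<close>
definition SCQ_generating :: "complex \<Rightarrow> real \<Rightarrow> nat \<Rightarrow> complex fps" where
  "SCQ_generating \<alpha> \<theta> p =
     (fps_binomial (- \<alpha>) oo (- fps_X)) * (\<Sum>i<p. fps_const (SCQ_gamma \<alpha> \<theta> i) * (1 - fps_X) ^ i)"

lemma inverse_nat_in_SCQ_steps:
  fixes \<theta> :: real
  shows "\<exists>\<delta>>0. \<forall>\<beta>. \<forall>N>0. 1 / real N \<in> SCQ_steps \<theta> \<beta> \<delta>"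
proof -
  define \<delta> where "\<delta> = (if frac \<theta> = 0 then 1 else frac \<theta>)"
  have pos: "\<delta> > 0"
    by (simp add: \<delta>_def frac_ge_0 order_less_le)
  have "1 / real N \<in> SCQ_steps \<theta> \<beta> \<delta>" if N: "N > 0" for \<beta> N
  proof -
    have False if "0 < 1 + (\<theta> - real j) * (1 / real N)"
      and "1 + (\<theta> - real j) * (1 / real N) < \<delta> * (1 / real N)" for j
    proof -
      define m :: int where "m = int N - int j + \<lfloor>\<theta>\<rfloor>"
      have th: "\<theta> = of_int \<lfloor>\<theta>\<rfloor> + frac \<theta>"
        by (simp add: frac_def)
      have node: "real N + \<theta> - real j = of_int m + frac \<theta>"
        unfolding m_def by (subst th) simp
      have "1 + (\<theta> - real j) * (1 / real N) = (real N + \<theta> - real j) / real N"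
        using N by (simp add: field_simps)
      then have a: "0 < real N + \<theta> - real j" and b: "real N + \<theta> - real j < \<delta>"
        using that N by (simp_all add: zero_less_divide_iff divide_less_cancel)
      have fr: "frac \<theta> < 1" "frac \<theta> \<ge> 0"
        by (simp_all add: frac_lt_1)
      have "\<delta> \<le> 1" "\<delta> = frac \<theta> \<or> frac \<theta> = 0"
        using fr by (simp_all add: \<delta>_def)
      moreover have "m > - 1" "m < 1"
        using a b fr \<open>\<delta> \<le> 1\<close> unfolding node by linarith+
      then have "m = 0"
        by simp
      ultimately show False
        using a b unfolding node by auto
    qed
    then show ?thesis
      using N unfolding SCQ_steps_def by auto
  qed
  with pos show ?thesis by blast
qed

end

theory Submission
  imports Defs
begin

text \<open>
  Write \<open>c\<^sub>k(a)\<close> for the coefficients of \<open>(1 - \<xi>)\<^sup>-\<^sup>a\<close>. If \<open>E\<^sub>i\<close> are the coefficients in powers of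
  \<open>1 - \<xi>\<close> of \<open>\<xi>\<^sup>-\<^sup>\<tau> (-ln \<xi> / (1 - \<xi>))\<^sup>-\<^sup>z\<close>, then, uniformly for bounded \<open>\<tau>\<close>, \<open>(k + \<tau>)\<^sup>z\<^sup>-\<^sup>1 / \<Gamma>(z)\<close> has the
  asymptotic expansion \<open>\<Sum>\<^sub>i E\<^sub>i c\<^sub>k(z - i)\<close> as \<open>k \<rightarrow> \<infinity>\<close>. For \<open>Re z < 1\<close> both sides are Laplace integrals
  and one compares their densities; a recurrence in \<open>z\<close> gives the general case.

  For \<open>1/h + \<theta> = N + \<tau>\<close> with \<open>0 < \<tau> \<le> 1\<close>, the quadrature sum for \<open>t\<^sup>\<beta>\<^sup>-\<^sup>1\<close> is a power of \<open>h\<close> times the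
  discrete convolution at \<open>N\<close> of the weights with \<open>(k + \<tau>)\<^sup>\<beta>\<^sup>-\<^sup>1\<close>. Inserting the expansion for \<open>z = \<beta>\<close>, the
  convolutions \<open>c(a) * c(b) = c(a + b)\<close> are exact, and the coefficients multiply like the symbols, which gives
  the expansion for \<open>z = \<alpha> + \<beta>\<close> with shift \<open>\<tau> - \<theta>\<close> up to order \<open>p\<close>, that is, of
  \<open>h\<^sup>1\<^sup>-\<^sup>\<alpha>\<^sup>-\<^sup>\<beta> / \<Gamma>(\<alpha> + \<beta>)\<close>. The terms of order \<open>\<ge> p\<close> contribute \<open>O(h\<^sup>p)\<close> to the error, and the
  rapidly decaying remainder of the expansion, convolved with weights of size \<open>N\<^sup>\<alpha>\<^sup>-\<^sup>1\<close>, contributes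
  \<open>O(h\<^sup>\<beta>)\<close>.
\<close>

subsection \<open>The Beta integral and Riemann-Liouville operators on powers\<close>

text \<open>The Gamma integrand extended by zero to the whole line, so that a product of two Gamma
  values becomes a convolution integral over the plane.\<close>

definition Gamma_density :: "complex \<Rightarrow> real \<Rightarrow> complex" where
  "Gamma_density a t = indicator {0<..} t *\<^sub>R (complex_of_real t powr (a - 1) / of_real (exp t))"

lemma borel_measurable_Gamma_density [measurable]: "Gamma_density a \<in> borel_measurable borel"
  unfolding Gamma_density_def [abs_def] by measurable

lemma Gamma_density_integral:
  fixes a :: complex
  assumes "Re a > 0"
  shows "integrable lborel (Gamma_density a)" "integral\<^sup>L lborel (Gamma_density a) = Gamma a"
proof -
  have "set_integrable lebesgue {0<..} (\<lambda>t. complex_of_real t powr (a - 1) / of_real (exp t))"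
    using absolutely_integrable_Gamma_integral'[OF assms(1)] .
  then have "integrable lebesgue (Gamma_density a)"
    unfolding set_integrable_def Gamma_density_def [abs_def] .
  then show i: "integrable lborel (Gamma_density a)"
    by (simp add: integrable_completion)
  then have "set_integrable lborel {0<..} (\<lambda>t. complex_of_real t powr (a - 1) / of_real (exp t))"
    unfolding set_integrable_def Gamma_density_def [abs_def] .
  from set_borel_integral_eq_integral(2)[OF this]
  show "integral\<^sup>L lborel (Gamma_density a) = Gamma a"
    unfolding set_lebesgue_integral_def Gamma_density_def
    using integral_unique[OF Gamma_integral_complex'[OF assms(1)]] by simp
qed

lemma powr_of_real_mult:
  assumes "x > 0" "y > 0"
  shows "complex_of_real (x * y) powr c = of_real x powr c * of_real y powr c"
  using assms by (simp add: powr_times_real)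

lemma set_integrable_Beta_complex:
  fixes a b :: complex
  assumes "Re a > 0" "Re b > 0"
  shows "set_integrable lborel {0<..<1} (\<lambda>t. complex_of_real t powr (a - 1) * of_real (1 - t) powr (b - 1))"
proof -
  have "set_integrable lborel {0<..<1} (\<lambda>t. t powr (Re a - 1) * (1 - t) powr (Re b - 1))"
    by (rule set_integrable_subset[OF integrable_Beta[OF assms]]) auto
  then have "integrable lborel (\<lambda>t. indicator {0<..<1} t *\<^sub>R (t powr (Re a - 1) * (1 - t) powr (Re b - 1)))"
    unfolding set_integrable_def .
  then show ?thesis
    unfolding set_integrable_def
    by (rule Bochner_Integration.integrable_bound)
       (auto simp: indicator_def norm_mult norm_powr_real_powr)
qed

text \<open>Homogeneity: the substitution t = x u pulls x^(a + b - 2) out of the integrand and one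
  more factor x out of the measure.\<close>

lemma Beta_scaled:
  fixes a b :: complex
  assumes "x > 0"
  shows lebesgue_integral_Beta_scaled:
      "(LBINT t:{0<..<x}. complex_of_real t powr (a - 1) * of_real (x - t) powr (b - 1)) =
           of_real x powr (a + b - 1) *
           (LBINT t:{0<..<1}. complex_of_real t powr (a - 1) * of_real (1 - t) powr (b - 1))"
    and set_integrable_Beta_scaled: "Re a > 0 \<Longrightarrow> Re b > 0 \<Longrightarrow>
      set_integrable lborel {0<..<x} (\<lambda>t. complex_of_real t powr (a - 1) * of_real (x - t) powr (b - 1))"
proof -
  define f where "f = (\<lambda>x t. indicator {0<..<x} t *\<^sub>R
     (complex_of_real t powr (a - 1) * of_real (x - t) powr (b - 1)))"
  have f: "f x (0 + x * t) = of_real x powr (a + b - 2) * f 1 t" for t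
  proof -
    have "complex_of_real (x * t) powr (a - 1) * of_real (x - x * t) powr (b - 1) =
      of_real x powr (a + b - 2) * (complex_of_real t powr (a - 1) * of_real (1 - t) powr (b - 1))"
      if "0 < t" "t < 1"
    proof -
      have "x - x * t = x * (1 - t)" by (simp add: algebra_simps)
      moreover have "of_real x powr (a + b - 2) = complex_of_real x powr (a - 1) * of_real x powr (b - 1)"
        by (simp flip: powr_add add: algebra_simps)
      ultimately show ?thesis using that assms by (simp add: powr_of_real_mult del: of_real_mult)
    qed
    moreover have "x * t \<in> {0<..<x} \<longleftrightarrow> t \<in> {0<..<1}"
      using assms by (auto simp: zero_less_mult_iff)
    ultimately show ?thesis
      by (auto simp: f_def indicator_def)
  qed
  have "(\<integral>t. f x t \<partial>lborel) = x *\<^sub>R (\<integral>t. f x (0 + x * t) \<partial>lborel)"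
    using assms by (subst lborel_integral_real_affine[of x _ 0]) auto
  also have "\<dots> = (of_real x * of_real x powr (a + b - 2)) * (\<integral>t. f 1 t \<partial>lborel)"
    unfolding f by (simp add: scaleR_conv_of_real)
  also have "of_real x * complex_of_real x powr (a + b - 2) = of_real x powr (1 + (a + b - 2))"
    using assms by (subst powr_add) simp
  finally show "(LBINT t:{0<..<x}. complex_of_real t powr (a - 1) * of_real (x - t) powr (b - 1)) =
           of_real x powr (a + b - 1) *
           (LBINT t:{0<..<1}. complex_of_real t powr (a - 1) * of_real (1 - t) powr (b - 1))"
    unfolding set_lebesgue_integral_def f_def by (simp add: algebra_simps)
  assume "Re a > 0" "Re b > 0"
  from set_integrable_Beta_complex[OF this]
  have "integrable lborel (f 1)"
    unfolding set_integrable_def f_def .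
  then have "integrable lborel (\<lambda>t. f x (0 + x * t))"
    unfolding f by (rule integrable_mult_right)
  then show "set_integrable lborel {0<..<x} (\<lambda>t. complex_of_real t powr (a - 1) * of_real (x - t) powr (b - 1))"
    using lborel_integrable_real_affine_iff[of x "f x" 0] assms unfolding set_integrable_def f_def by auto
qed

lemma Re_pos_not_nonpos_Int: "Re z > 0 \<Longrightarrow> z \<notin> \<int>\<^sub>\<le>\<^sub>0"
  by (auto elim!: nonpos_Ints_cases)

text \<open>Integrating \<open>K\<close> over the plane first in x gives Gamma a * Gamma b. First in
  t, the exponentials combine to e^(-x) and a Beta integral scaled to (0, x) remains, which gives B
  * Gamma (a + b).\<close>

lemma lebesgue_integral_Beta_complex:
  fixes a b :: complex
  assumes a: "Re a > 0" and b: "Re b > 0"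
  shows "(LBINT t:{0<..<1}. complex_of_real t powr (a - 1) * of_real (1 - t) powr (b - 1)) = Beta a b"
proof -
  define B where "B = (LBINT t:{0<..<1}. complex_of_real t powr (a - 1) * of_real (1 - t) powr (b - 1))"
  note gk = Gamma_density_integral
  define K where "K = (\<lambda>(t, x). Gamma_density a t * Gamma_density b (x - t))"
  have [measurable]: "K \<in> borel_measurable (lborel \<Otimes>\<^sub>M lborel)"
    unfolding K_def by measurable
  have shift: "integrable lborel (\<lambda>x. Gamma_density b (x - t))" "(\<integral>x. Gamma_density b (x - t) \<partial>lborel) = Gamma b"
    "(\<integral>x. norm (Gamma_density b (x - t)) \<partial>lborel) = (\<integral>x. norm (Gamma_density b x) \<partial>lborel)" for t
  proof -
    show "integrable lborel (\<lambda>x. Gamma_density b (x - t))"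
      using lborel_integrable_real_affine[OF gk(1)[OF b], of 1 "-t"] by simp
    show "(\<integral>x. Gamma_density b (x - t) \<partial>lborel) = Gamma b"
      using lborel_integral_real_affine[of 1 "Gamma_density b" "-t"] gk(2)[OF b] by simp
    show "(\<integral>x. norm (Gamma_density b (x - t)) \<partial>lborel) = (\<integral>x. norm (Gamma_density b x) \<partial>lborel)"
      using lborel_integral_real_affine[of 1 "\<lambda>x. norm (Gamma_density b x)" "-t"] by simp
  qed
  have int: "integrable (lborel \<Otimes>\<^sub>M lborel) K"
  proof (rule lborel_pair.Fubini_integrable)
    have "integrable lborel (\<lambda>t. norm (Gamma_density a t) * (\<integral>x. norm (Gamma_density b x) \<partial>lborel))"
      by (intro integrable_mult_left integrable_norm gk a)
    then show "integrable lborel (\<lambda>t. \<integral>x. norm (K (t, x)) \<partial>lborel)"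
      by (simp add: K_def norm_mult shift)
    show "AE t in lborel. integrable lborel (\<lambda>x. K (t, x))"
      unfolding K_def by (auto intro!: shift)
  qed simp
  then have int': "integrable (lborel \<Otimes>\<^sub>M lborel) (case_prod (\<lambda>t x. K (t, x)))"
    by simp
  have "Gamma a * Gamma b = (\<integral>t. (\<integral>x. K (t, x) \<partial>lborel) \<partial>lborel)"
    by (simp add: K_def shift gk a)
  also have "\<dots> = (\<integral>x. (\<integral>t. K (t, x) \<partial>lborel) \<partial>lborel)"
    using lborel_pair.integral_snd[OF int'] lborel_pair.integral_fst[OF int'] by simp
  also have "\<dots> = (\<integral>x. B * Gamma_density (a + b) x \<partial>lborel)"
  proof (rule Bochner_Integration.integral_cong [OF refl])
    fix x :: real
    show "(\<integral>t. K (t, x) \<partial>lborel) = B * Gamma_density (a + b) x"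
    proof (cases "x > 0")
      case True
      have "(\<integral>t. K (t, x) \<partial>lborel) = (\<integral>t. inverse (of_real (exp x)) *
         (indicator {0<..<x} t *\<^sub>R (complex_of_real t powr (a - 1) * of_real (x - t) powr (b - 1))) \<partial>lborel)"
        by (rule Bochner_Integration.integral_cong)
           (auto simp: K_def Gamma_density_def indicator_def exp_diff field_simps)
      also have "\<dots> = inverse (of_real (exp x)) * (of_real x powr (a + b - 1) * B)"
        using lebesgue_integral_Beta_scaled[OF True, of a b]
        unfolding B_def set_lebesgue_integral_def by (simp only: integral_mult_right_zero)
      finally show ?thesis using True by (simp add: Gamma_density_def field_simps)
    next
      case False
      then have "K (t, x) = 0" for t
        by (auto simp: K_def Gamma_density_def indicator_def)
      then show ?thesis using False by (simp add: Gamma_density_def)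
    qed
  qed
  also have "\<dots> = B * Gamma (a + b)"
    using a b by (simp add: gk)
  finally show ?thesis
    using a b Re_pos_not_nonpos_Int[of "a + b"]
    by (simp add: B_def Beta_def Gamma_eq_zero_iff)
qed

lemma RL_integral_pow_fun:
  assumes "Re a > 0" "Re \<beta> > 0" "x > 0"
  shows "RL_integral a (pow_fun \<beta>) x = Gamma \<beta> * rGamma (a + \<beta>) * of_real x powr (a + \<beta> - 1)"
proof -
  \<comment> \<open>On the open interval \<open>pow_fun \<beta>\<close> is the library power also
    for \<beta> = 1; the two can differ only at the endpoint 0.\<close>
  have "integral {0..x} (\<lambda>s. complex_of_real (x - s) powr (a - 1) * pow_fun \<beta> s) =
        integral {0<..<x} (\<lambda>s. complex_of_real (x - s) powr (a - 1) * pow_fun \<beta> s)"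
    by (rule integral_open_interval_real)
  also have "\<dots> = integral {0<..<x} (\<lambda>s. complex_of_real s powr (\<beta> - 1) * of_real (x - s) powr (a - 1))"
    by (rule integral_cong) (auto simp: pow_fun_def)
  also have "\<dots> = of_real x powr (\<beta> + a - 1) * Beta \<beta> a"
    using set_borel_integral_eq_integral(2)[OF set_integrable_Beta_scaled[of x \<beta> a]] assms
    unfolding lebesgue_integral_Beta_scaled[OF assms(3)] lebesgue_integral_Beta_complex[OF assms(2,1)]
    by simp
  finally show ?thesis
    using Re_pos_not_nonpos_Int[OF assms(1)]
    by (simp add: RL_integral_def Beta_altdef Gamma_eq_zero_iff add.commute)
qed

text \<open>Differentiation brings down the factor c - 1, and (c - 1) * rGamma c = rGamma (c - 1).
  Since \<open>rGamma\<close> is entire, the formula stays valid when a power is differentiated to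
  zero.\<close>

lemma funpow_vector_derivative_powr:
  assumes "\<And>x. x > 0 \<Longrightarrow> g x = K * rGamma c * complex_of_real x powr (c - 1)" and "x > 0"
  shows "((\<lambda>u x. vector_derivative u (at x)) ^^ n) g x =
           K * rGamma (c - of_nat n) * of_real x powr (c - of_nat n - 1)"
  using assms(2)
proof (induction n arbitrary: x)
  case 0
  then show ?case using assms(1) by simp
next
  case (Suc n)
  let ?D = "\<lambda>(u::real \<Rightarrow> complex) x. vector_derivative u (at x)"
  define d where "d = c - of_nat n"
  have "((\<lambda>z. K * rGamma d * z powr (d - 1)) has_field_derivative
          K * rGamma d * ((d - 1) * complex_of_real x powr (d - 1 - 1))) (at (complex_of_real x))"
    using Suc.prems by (auto intro!: derivative_eq_intros)
  then have "((\<lambda>y. K * rGamma d * complex_of_real y powr (d - 1)) has_vector_derivative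
          K * rGamma d * ((d - 1) * complex_of_real x powr (d - 1 - 1))) (at x)"
    by (rule has_vector_derivative_real_field)
  then have "((?D ^^ n) g has_vector_derivative
          K * rGamma d * ((d - 1) * complex_of_real x powr (d - 1 - 1))) (at x)"
    by (rule has_vector_derivative_transform_within_open[of _ _ _ "{0<..}"])
       (use Suc in \<open>auto simp: d_def\<close>)
  then have "?D ((?D ^^ n) g) x = K * rGamma d * ((d - 1) * complex_of_real x powr (d - 1 - 1))"
    by (rule vector_derivative_at)
  also have "\<dots> = K * ((d - 1) * rGamma (d - 1 + 1)) * complex_of_real x powr (d - 1 - 1)"
    by simp
  also have "(d - 1) * rGamma (d - 1 + 1) = rGamma (d - 1)"
    by (rule rGamma_plus1)
  finally show ?case
    by (simp add: d_def algebra_simps)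
qed

text \<open>By the choice of \<open>RL_shift\<close>, the operator of order a = n + \<alpha> is the
  identity or a convergent integral. On x > 0 both give the same multiple of a power, and n
  derivatives lower a + \<beta> to \<alpha> + \<beta>.\<close>

lemma RL_pow_fun:
  assumes "Re \<beta> > 0" "x > 0"
  shows "RL \<alpha> (pow_fun \<beta>) x = Gamma \<beta> * rGamma (\<alpha> + \<beta>) * of_real x powr (\<alpha> + \<beta> - 1)"
proof -
  define n where "n = RL_shift \<alpha>"
  define a where "a = of_nat n + \<alpha>"
  define g where "g = (if a = 0 then pow_fun \<beta> else RL_integral a (pow_fun \<beta>))"
  obtain m :: nat where "- Re \<alpha> < of_nat m"
    using reals_Archimedean2 by blast
  then have "of_nat m + \<alpha> = 0 \<or> Re (of_nat m + \<alpha>) > 0"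
    by simp
  then have a: "a = 0 \<or> Re a > 0"
    unfolding a_def n_def RL_shift_def by (rule LeastI)
  have "Gamma \<beta> * rGamma \<beta> = 1"
    using Re_pos_not_nonpos_Int[OF assms(1)] by (simp add: Gamma_def rGamma_eq_zero_iff)
  then have "g y = Gamma \<beta> * rGamma (a + \<beta>) * of_real y powr (a + \<beta> - 1)" if "y > 0" for y
  proof (cases "a = 0")
    case True
    with that \<open>Gamma \<beta> * rGamma \<beta> = 1\<close> show ?thesis by (simp add: g_def pow_fun_def)
  next
    case False
    with a show ?thesis using RL_integral_pow_fun[OF _ assms(1) that] by (simp add: g_def)
  qed
  note * = funpow_vector_derivative_powr[OF this assms(2), of n]
  have e: "a + \<beta> - of_nat n = \<alpha> + \<beta>"
    by (simp add: a_def)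
  show ?thesis
    using *[unfolded e] unfolding RL_def Let_def n_def a_def g_def by blast
qed

text \<open>For Re \<beta> > 0 this is the computed value, elsewhere the definition, so from here on
  no case split on \<beta> remains.\<close>

lemma RL_power_eq:
  assumes "x > 0"
  shows "RL_power \<alpha> \<beta> x = Gamma \<beta> * rGamma (\<alpha> + \<beta>) * of_real x powr (\<alpha> + \<beta> - 1)"
  unfolding RL_power_def using RL_pow_fun[OF _ assms] by presburger

subsection \<open>Coefficients of the binomial series\<close>

text \<open>The power series of (1 - \<xi>)^(-a), whose coefficients are the
  \<open>c\<^sub>k(a)\<close> of the overview; they grow at most like k^(Re a - 1).\<close>

definition binomial_series :: "complex \<Rightarrow> complex fps" where
  "binomial_series a = fps_binomial (- a) oo (- fps_X)"

lemma binomial_series_nth: "fps_nth (binomial_series a) k = pochhammer a k / fact k"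
proof -
  have "binomial_series a = fps_compose (fps_binomial (-a)) (fps_const (-1) * fps_X)"
    by (simp add: binomial_series_def flip: fps_const_neg)
  then show ?thesis
    by (simp add: fps_compose_linear gbinomial_pochhammer flip: power_mult_distrib)
qed

lemma binomial_series_add: "binomial_series (a + b) = binomial_series a * binomial_series b"
  unfolding binomial_series_def minus_add_distrib fps_binomial_add_mult
  by (rule fps_compose_mult_distrib) simp

lemma binomial_series_power: "(1 - fps_X) ^ i * binomial_series a = binomial_series (a - of_nat i)"
proof -
  have "binomial_series (- of_nat i) = (1 + fps_X) ^ i oo (- fps_X)"
    unfolding binomial_series_def by (simp add: fps_binomial_of_nat)
  also have "\<dots> = (1 - fps_X) ^ i"
    by (simp add: fps_compose_add_distrib flip: fps_compose_power)
  finally have "(1 - fps_X) ^ i * binomial_series a = binomial_series (- of_nat i) * binomial_series a"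
    by simp
  then show ?thesis by (simp flip: binomial_series_add)
qed

text \<open>The power with exponent q is increasing or decreasing in its base according to the sign
  of q. The exponent |q| on the comparison factor covers both cases, as later exponents have no
  fixed sign.\<close>

lemma powr_le_powr_comparable:
  fixes x y c q :: real
  assumes "x > 0" "y > 0" "y \<le> c * x" "x \<le> c * y"
  shows "y powr q \<le> c powr \<bar>q\<bar> * x powr q"
proof -
  have c: "c > 0"
    using assms by (metis less_le_trans zero_less_mult_pos2)
  show ?thesis
  proof (cases "q \<ge> 0")
    case True
    then have "y powr q \<le> (c * x) powr q"
      using assms by (intro powr_mono2) auto
    then show ?thesis using True assms c by (simp add: powr_mult)
  next
    case False
    have "y powr q \<le> (x / c) powr q"
      using False assms c by (intro powr_mono2') (auto simp: field_simps)
    also have "\<dots> = c powr \<bar>q\<bar> * x powr q"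
      using False assms c by (simp add: powr_divide powr_minus field_simps)
    finally show ?thesis .
  qed
qed

text \<open>The coefficient of index k = n + 1 is n^a / (n + 1) times
  \<open>rGamma_series a n\<close>, and that sequence converges, hence is bounded.\<close>

lemma binomial_series_nth_bound:
  obtains C where "C > 0"
    "\<And>k. norm (fps_nth (binomial_series a) k) \<le> C * (real k + 1) powr (Re a - 1)"
proof -
  have "Bseq (rGamma_series a)"
    using rGamma_series_LIMSEQ convergentI convergent_imp_Bseq by blast
  then obtain B where B: "B > 0" "\<And>n. norm (rGamma_series a n) \<le> B"
    by (auto elim!: BseqE)
  define f where "f = (\<lambda>k. norm (fps_nth (binomial_series a) k))"
  \<comment> \<open>One entry each for k = 0, for k = 1, and for k = n + 1 with n > 0. In the last
    case n and k + 1 = n + 2 differ by a factor of at most 3, and k is at least (k + 1) / 2.\<close>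
  define C where "C = max 1 (max (f 1 * 2 powr (1 - Re a)) (B * 3 powr \<bar>Re a\<bar> * 2))"
  have "f k \<le> C * (real k + 1) powr (Re a - 1)" for k
  proof -
    consider "k = 0" | "k = 1" | n where "k = Suc n" "n > 0"
      by (cases k; cases "k = 1") auto
    then show ?thesis
    proof cases
      case 1
      then show ?thesis by (simp add: f_def binomial_series_nth C_def)
    next
      case 2
      have "f 1 = f 1 * 2 powr (1 - Re a) * 2 powr (Re a - 1)"
        by (simp flip: powr_add)
      also have "\<dots> \<le> C * 2 powr (Re a - 1)"
        by (rule mult_right_mono) (auto simp: C_def)
      finally show ?thesis using 2 by simp
    next
      case (3 n)
      have "pochhammer a (Suc n) / fact (Suc n) =
              rGamma_series a n * of_real (real n) powr a / of_nat (Suc n)"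
        using 3 by (simp add: rGamma_series_def powr_def divide_simps del: of_nat_Suc)
      then have "f k = norm (rGamma_series a n) * real n powr Re a / real k"
        using 3 norm_powr_real_powr[of "complex_of_nat n" a]
        unfolding f_def binomial_series_nth
        by (simp add: norm_mult norm_divide del: of_nat_Suc)
      also have "\<dots> \<le> B * (3 powr \<bar>Re a\<bar> * (real k + 1) powr Re a) / ((real k + 1) / 2)"
        using B(2)[of n] B(1) 3
        by (intro frac_le mult_mono powr_le_powr_comparable) auto
      also have "\<dots> = B * 3 powr \<bar>Re a\<bar> * 2 * (real k + 1) powr (Re a - 1)"
        by (simp add: powr_diff)
      also have "\<dots> \<le> C * (real k + 1) powr (Re a - 1)"
        by (rule mult_right_mono) (auto simp: C_def)
      finally show ?thesis .
    qed
  qed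
  moreover have "C > 0" by (auto simp: C_def)
  ultimately show ?thesis using that unfolding f_def by blast
qed

subsection \<open>The symbol and its Taylor expansion\<close>

text \<open>The base -ln \<xi> / (1 - \<xi>) in the variable u = 1 - \<xi>, with its singularity
  removed; the symbol is then a product of two powers without a separate case at \<xi> = 1.\<close>

definition log_ratio :: "complex \<Rightarrow> complex" where
  "log_ratio u = (if u = 0 then 1 else - ln (1 - u) / u)"

lemma SCQ_symbol_log_ratio:
  "SCQ_symbol z \<theta> (1 - u) = (1 - u) powr of_real \<theta> * log_ratio u powr (- z)"
  by (simp add: SCQ_symbol_def log_ratio_def)

lemma one_minus_not_nonpos_Real:
  fixes u :: complex
  assumes "norm u < 1"
  shows "1 - u \<notin> \<real>\<^sub>\<le>\<^sub>0"
proof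
  assume "1 - u \<in> \<real>\<^sub>\<le>\<^sub>0"
  then have "Re u \<ge> 1" by (simp add: complex_nonpos_Reals_iff)
  with complex_Re_le_cmod[of u] assms show False by simp
qed

text \<open>By the linear approximation of Ln, 1 - log_ratio u has norm at most norm u / (1 - norm
  u), which is below 1 on the disc of radius 1/2. This is why the symbol is treated on that disc:
  there the principal power of \<open>log_ratio\<close> is holomorphic.\<close>

lemma log_ratio_not_nonpos_Real:
  assumes "norm u < 1 / 2"
  shows "log_ratio u \<notin> \<real>\<^sub>\<le>\<^sub>0"
proof (cases "u = 0")
  case False
  have "norm (ln (1 + (- u)) - (- u)) \<le> norm (- u) ^ 2 / (1 - norm (- u))"
    by (rule Ln_approx_linear) (use assms in simp)
  then have 1: "norm (ln (1 - u) + u) \<le> norm u ^ 2 / (1 - norm u)"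
    by simp
  have "1 - log_ratio u = (ln (1 - u) + u) / u"
    using False by (simp add: log_ratio_def field_simps)
  then have "norm (1 - log_ratio u) = norm (ln (1 - u) + u) / norm u"
    by (simp add: norm_divide)
  also have "\<dots> \<le> (norm u ^ 2 / (1 - norm u)) / norm u"
    using 1 by (rule divide_right_mono) simp
  also have "\<dots> < 1"
    using False assms by (simp add: power2_eq_square field_simps)
  finally show ?thesis
    using one_minus_not_nonpos_Real[of "1 - log_ratio u"] by simp
qed (simp add: log_ratio_def)

text \<open>It is the difference quotient of -ln (1 - u) at 0, completed by the derivative 1, so the
  singularity is removable.\<close>

lemma holomorphic_log_ratio: "log_ratio holomorphic_on ball 0 1"
proof -
  let ?g = "\<lambda>u::complex. - ln (1 - u)"
  have d: "(?g has_field_derivative 1) (at 0)"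
    by (auto intro!: derivative_eq_intros)
  have "?g holomorphic_on ball 0 1"
    using one_minus_not_nonpos_Real by (intro holomorphic_intros) auto
  then have "(\<lambda>u. if u = 0 then deriv ?g 0 else (?g u - ?g 0) / (u - 0)) holomorphic_on ball 0 1"
    by (rule pole_lemma_open) simp
  then show ?thesis
    using DERIV_imp_deriv[OF d] by (simp add: log_ratio_def [abs_def] cong: if_cong)
qed

lemma holomorphic_symbol: "(\<lambda>u. SCQ_symbol z \<theta> (1 - u)) holomorphic_on ball 0 (1 / 2)"
proof -
  have "log_ratio holomorphic_on ball 0 (1 / 2)"
    by (rule holomorphic_on_subset[OF holomorphic_log_ratio]) auto
  then show ?thesis
    unfolding SCQ_symbol_log_ratio
    using one_minus_not_nonpos_Real log_ratio_not_nonpos_Real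
    by (intro holomorphic_intros) auto
qed

text \<open>Used in three roles: (\<alpha>, \<theta>) gives the \<gamma> of the weights, (\<beta>,
  -\<tau>) the expansion of the sampled power, and (\<alpha> + \<beta>, \<theta> - \<tau>) the
  expansion of the exact value.\<close>

definition symbol_fps :: "complex \<Rightarrow> real \<Rightarrow> complex fps" where
  "symbol_fps z \<theta> = fps_expansion (\<lambda>u. SCQ_symbol z \<theta> (1 - u)) 0"

lemma has_fps_expansion_symbol:
  "(\<lambda>u. SCQ_symbol z \<theta> (1 - u)) has_fps_expansion symbol_fps z \<theta>"
  unfolding symbol_fps_def
  by (rule has_fps_expansion_fps_expansion[OF _ _ holomorphic_symbol]) auto

text \<open>All symbols are products of principal powers of the same two bases 1 - u and log_ratio
  u, so exponents add; uniqueness of the expansion carries this over to the coefficients.\<close>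

lemma symbol_fps_mult:
  "symbol_fps z \<theta> * symbol_fps z' \<theta>' = symbol_fps (z + z') (\<theta> + \<theta>')"
proof (rule fps_expansion_unique_complex)
  show "(\<lambda>u. SCQ_symbol z \<theta> (1 - u) * SCQ_symbol z' \<theta>' (1 - u))
          has_fps_expansion symbol_fps z \<theta> * symbol_fps z' \<theta>'"
    by (intro fps_expansion_intros has_fps_expansion_symbol)
  have "(\<lambda>u. SCQ_symbol z \<theta> (1 - u) * SCQ_symbol z' \<theta>' (1 - u)) =
        (\<lambda>u. SCQ_symbol (z + z') (\<theta> + \<theta>') (1 - u))"
    unfolding SCQ_symbol_log_ratio by (intro ext) (simp add: powr_add [symmetric] mult_ac)
  then show "(\<lambda>u. SCQ_symbol z \<theta> (1 - u) * SCQ_symbol z' \<theta>' (1 - u))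
          has_fps_expansion symbol_fps (z + z') (\<theta> + \<theta>')"
    by (simp add: has_fps_expansion_symbol)
qed

lemma symbol_fps_nth_0 [simp]: "fps_nth (symbol_fps z \<theta>) 0 = 1"
  by (simp add: symbol_fps_def fps_expansion_def SCQ_symbol_def)

text \<open>The logarithmic derivative of the symbol contains 1 / log_ratio u, and dividing the
  symbol by log_ratio u raises z by one. Eliminating this quotient leaves a first-order differential
  relation between the symbols for z and z + 1, which drives the induction on z.\<close>

lemma symbol_fps_recurrence:
  "fps_const z * symbol_fps (z + 1) \<theta> =
     symbol_fps z \<theta> * (fps_const z - fps_const (z + of_real \<theta>) * fps_X)
       - fps_X * (1 - fps_X) * fps_deriv (symbol_fps z \<theta>)"
proof (rule fps_expansion_unique_complex)
  let ?f = "\<lambda>z u. SCQ_symbol z \<theta> (1 - u)"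
  let ?g = "\<lambda>u. ?f z u * (z - (z + of_real \<theta>) * u) - u * (1 - u) * deriv (?f z) u"
  show "?g has_fps_expansion symbol_fps z \<theta> * (fps_const z - fps_const (z + of_real \<theta>) * fps_X)
       - fps_X * (1 - fps_X) * fps_deriv (symbol_fps z \<theta>)"
    by (intro fps_expansion_intros has_fps_expansion_symbol)
  have "z * ?f (z + 1) u = ?g u" if "norm u < 1 / 2" for u
  proof (cases "u = 0")
    case False
    define l where "l = ln (1 - u)"
    have nz: "1 - u \<noteq> 0" "log_ratio u \<noteq> 0" "1 - u \<notin> \<real>\<^sub>\<le>\<^sub>0" "log_ratio u \<notin> \<real>\<^sub>\<le>\<^sub>0"
      using one_minus_not_nonpos_Real[of u] log_ratio_not_nonpos_Real[of u] that by auto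
    have lr: "log_ratio u = - l / u" and l: "l \<noteq> 0"
      using False nz by (auto simp: log_ratio_def l_def)
    have "((\<lambda>u. - ln (1 - u) / u) has_field_derivative (1 / (1 - u) / u + l / u ^ 2)) (at u)"
      using nz False unfolding l_def
      by (auto intro!: derivative_eq_intros simp: field_simps power2_eq_square)
    then have L': "(log_ratio has_field_derivative (1 / (1 - u) / u + l / u ^ 2)) (at u)"
      by (rule has_field_derivative_transform_within_open[of _ _ _ "- {0}"])
         (use False in \<open>auto simp: log_ratio_def\<close>)
    have "(?f z has_field_derivative
        - (of_real \<theta> * (1 - u) powr (of_real \<theta> - 1)) * log_ratio u powr (- z) +
        (- z * log_ratio u powr (- z - 1) * (1 / (1 - u) / u + l / u ^ 2)) * (1 - u) powr of_real \<theta>) (at u)"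
      unfolding SCQ_symbol_log_ratio
      using nz by (auto intro!: derivative_eq_intros L')
    then have "deriv (?f z) u = - (of_real \<theta> * (1 - u) powr (of_real \<theta> - 1)) * log_ratio u powr (- z) +
        (- z * log_ratio u powr (- z - 1) * (1 / (1 - u) / u + l / u ^ 2)) * (1 - u) powr of_real \<theta>"
      by (rule DERIV_imp_deriv)
    also have "\<dots> = ?f z u * (- of_real \<theta> / (1 - u) - z / log_ratio u * (1 / (1 - u) / u + l / u ^ 2))"
      using nz by (simp add: SCQ_symbol_log_ratio powr_diff algebra_simps divide_simps)
    finally have d: "deriv (?f z) u = \<dots>" .
    have e: "?f (z + 1) u = ?f z u / log_ratio u"
      using nz by (simp add: SCQ_symbol_log_ratio powr_diff)
    \<comment> \<open>Here v stands for 1 - u and t for \<theta>. The term z * u / l equals -z /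
      log_ratio u and is the only one that does not cancel afterwards.\<close>
    have "u * v * (- t / v - z / (- l / u) * (1 / v / u + l / u ^ 2)) = z * u / l + z * v - t * u"
      if "v \<noteq> 0" for v t
      using l False that by (simp add: field_simps power2_eq_square)
    from this[OF nz(1)]
    have "u * (1 - u) * deriv (?f z) u = ?f z u * (z * u / l + z * (1 - u) - of_real \<theta> * u)"
      unfolding d lr by (simp only: mult.left_commute[of _ "?f z u"])
    then show ?thesis
      unfolding e lr using l False by (simp add: field_simps)
  qed (simp add: SCQ_symbol_def)
  then have ev: "eventually (\<lambda>u. z * ?f (z + 1) u = ?g u) (nhds 0)"
    by (intro eventually_nhds_in_open[of "ball 0 (1/2)", THEN eventually_mono]) auto
  have "(\<lambda>u. z * ?f (z + 1) u) has_fps_expansion fps_const z * symbol_fps (z + 1) \<theta>"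
    by (intro fps_expansion_intros has_fps_expansion_symbol)
  then show "?g has_fps_expansion fps_const z * symbol_fps (z + 1) \<theta>"
    using has_fps_expansion_cong[OF ev refl] by simp
qed

text \<open>The bound must be uniform in \<theta>. Compactness handles the factor free of \<theta>,
  and norm (ln (1 - u)) <= 1 bounds the factor (1 - u)^\<theta> explicitly.\<close>

lemma symbol_bounded:
  obtains B where "B > 0"
    "\<And>\<theta> u. \<bar>\<theta>\<bar> \<le> T \<Longrightarrow> norm u \<le> 1 / 3 \<Longrightarrow> norm (SCQ_symbol z \<theta> (1 - u)) \<le> B"
proof -
  have c: "compact (cball (0::complex) (1/3))" by simp
  have "continuous_on (cball 0 (1/3)) (\<lambda>u. SCQ_symbol z 0 (1 - u))"
    by (rule holomorphic_on_imp_continuous_on, rule holomorphic_on_subset[OF holomorphic_symbol]) auto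
  from compact_imp_bounded[OF compact_continuous_image[OF this c]] obtain B1 where
    B1: "\<And>u. norm u \<le> 1/3 \<Longrightarrow> norm (SCQ_symbol z 0 (1 - u)) \<le> B1"
    unfolding bounded_iff by (metis (no_types, lifting) imageI mem_cball_0)
  have B10: "B1 \<ge> 0" using B1[of 0] norm_ge_zero order_trans by (metis norm_zero zero_le_divide_1_iff zero_le_numeral)
  have "norm (SCQ_symbol z \<theta> (1 - u)) \<le> exp (\<bar>T\<bar>) * B1 + 1"
    if "\<bar>\<theta>\<bar> \<le> T" "norm u \<le> 1 / 3" for \<theta> u
  proof -
    have nz: "1 - u \<noteq> 0" using that by auto
    have "norm (ln (1 + (- u))) \<le> 2 * norm (- u)"
      by (rule norm_Ln_le) (use that in simp)
    then have ln: "norm (ln (1 - u)) \<le> 1" using that by simp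
    have "norm ((1 - u) powr of_real \<theta>) = exp (Re (of_real \<theta> * ln (1 - u)))"
      using nz by (simp add: powr_def norm_exp_eq_Re del: Re_complex_of_real)
    also have "\<dots> \<le> exp (\<bar>T\<bar>)"
    proof -
      have "Re (of_real \<theta> * ln (1 - u)) \<le> \<bar>\<theta>\<bar> * norm (ln (1 - u))"
        by (metis complex_Re_le_cmod norm_mult norm_of_real)
      also have "\<dots> \<le> \<bar>T\<bar> * 1" using that ln by (intro mult_mono) auto
      finally show ?thesis by simp
    qed
    finally have "norm ((1 - u) powr of_real \<theta>) \<le> exp \<bar>T\<bar>" .
    then have "norm (SCQ_symbol z \<theta> (1 - u)) \<le> exp \<bar>T\<bar> * B1"
      using B1[OF that(2)] nz unfolding SCQ_symbol_log_ratio norm_mult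
      by (intro mult_mono) auto
    then show ?thesis by simp
  qed
  moreover have "exp (\<bar>T\<bar>) * B1 + 1 > 0" using B10 by (simp add: add_nonneg_pos)
  ultimately show ?thesis using that by blast
qed

text \<open>Cauchy's inequality on the disc of radius 1/3 gives the factor 3^i. For norm u <= 1/6
  the Taylor tail is dominated by a geometric series of ratio at most 1/2, whence the factor
  2.\<close>

lemma symbol_fps_bounds:
  obtains B where "B > 0"
    "\<And>\<theta> i. \<bar>\<theta>\<bar> \<le> T \<Longrightarrow> norm (fps_nth (symbol_fps z \<theta>) i) \<le> B * 3 ^ i"
    "\<And>\<theta> u M. \<bar>\<theta>\<bar> \<le> T \<Longrightarrow> norm u \<le> 1 / 6 \<Longrightarrow>
      norm (SCQ_symbol z \<theta> (1 - u) - (\<Sum>i<M. fps_nth (symbol_fps z \<theta>) i * u ^ i)) \<le> 2 * B * (3 * norm u) ^ M"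
proof -
  obtain B where B: "B > 0"
    "\<And>\<theta> u. \<bar>\<theta>\<bar> \<le> T \<Longrightarrow> norm u \<le> 1 / 3 \<Longrightarrow> norm (SCQ_symbol z \<theta> (1 - u)) \<le> B"
    using symbol_bounded[of T z] by blast
  have 1: "norm (fps_nth (symbol_fps z \<theta>) i) \<le> B * 3 ^ i" if "\<bar>\<theta>\<bar> \<le> T" for \<theta> i
  proof -
    have hol: "(\<lambda>u. SCQ_symbol z \<theta> (1 - u)) holomorphic_on cball 0 (1/3)"
      by (rule holomorphic_on_subset[OF holomorphic_symbol]) auto
    have "norm ((deriv ^^ i) (\<lambda>u. SCQ_symbol z \<theta> (1 - u)) 0) \<le> fact i * B / (1/3) ^ i"
    proof (rule Cauchy_inequality)
      show "(\<lambda>u. SCQ_symbol z \<theta> (1 - u)) holomorphic_on ball 0 (1/3)"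
        using hol by (rule holomorphic_on_subset) auto
      show "continuous_on (cball 0 (1/3)) (\<lambda>u. SCQ_symbol z \<theta> (1 - u))"
        using hol by (rule holomorphic_on_imp_continuous_on)
    qed (use B that in auto)
    then show ?thesis
      by (simp add: symbol_fps_def fps_expansion_def norm_divide field_simps)
  qed
  have 2: "norm (SCQ_symbol z \<theta> (1 - u) - (\<Sum>i<M. fps_nth (symbol_fps z \<theta>) i * u ^ i)) \<le> 2 * B * (3 * norm u) ^ M"
    if \<theta>: "\<bar>\<theta>\<bar> \<le> T" and u: "norm u \<le> 1 / 6" for \<theta> u M
  proof -
    let ?a = "fps_nth (symbol_fps z \<theta>)"
    let ?q = "3 * norm u"
    have "(\<lambda>i. ?a i * u ^ i) sums SCQ_symbol z \<theta> (1 - u)"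
      using holomorphic_power_series[OF holomorphic_symbol[of z \<theta>], of u] u
      by (simp add: symbol_fps_def fps_expansion_def)
    from sums_split_initial_segment[OF this, of M]
    have "SCQ_symbol z \<theta> (1 - u) - (\<Sum>i<M. ?a i * u ^ i) = (\<Sum>i. ?a (i + M) * u ^ (i + M))"
      by (simp add: sums_iff)
    also have "norm \<dots> \<le> (\<Sum>i. B * ?q ^ M * ?q ^ i)"
    proof (rule norm_suminf_le)
      fix i
      have "norm (?a (i + M) * u ^ (i + M)) \<le> (B * 3 ^ (i + M)) * norm u ^ (i + M)"
        unfolding norm_mult norm_power by (intro mult_right_mono 1 \<theta>) simp
      also have "\<dots> = B * ?q ^ M * ?q ^ i" by (simp add: power_add power_mult_distrib)
      finally show "norm (?a (i + M) * u ^ (i + M)) \<le> B * ?q ^ M * ?q ^ i" .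
      show "summable (\<lambda>i. B * ?q ^ M * ?q ^ i)"
        using u by (intro summable_mult summable_geometric) simp
    qed
    also have "\<dots> = B * ?q ^ M * (1 / (1 - ?q))"
      using u by (subst suminf_mult) (auto simp: suminf_geometric intro!: summable_geometric)
    also have "\<dots> \<le> B * ?q ^ M * 2"
      using u B by (intro mult_left_mono) (auto simp: field_simps)
    finally show ?thesis by (simp add: mult_ac)
  qed
  show ?thesis using that[OF B(1) 1 2] .
qed

subsection \<open>Laplace integrals\<close>

text \<open>Substitution t = y s in the Gamma integral, giving the Laplace transform of s^(b - 1) at
  y.\<close>

lemma Gamma_integral_scaled:
  fixes b :: complex
  assumes "Re b > 0" "y > 0"
  shows "(\<lambda>s. of_real (exp (- y * s)) * of_real s powr (b - 1)) absolutely_integrable_on {0<..}"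
        "integral {0<..} (\<lambda>s. of_real (exp (- y * s)) * complex_of_real s powr (b - 1)) =
           Gamma b * of_real y powr (- b)"
proof -
  define f where "f = (\<lambda>t. complex_of_real t powr (b - 1) / of_real (exp t))"
  have img: "(\<lambda>s. y * s) ` {0<..} = {0<..}"
    using assms(2) by (auto simp: image_iff zero_less_mult_iff intro!: bexI[of _ "_ / y"])
  have "f absolutely_integrable_on {0<..} \<and> integral {0<..} f = Gamma b"
    using absolutely_integrable_Gamma_integral'[OF assms(1)] Gamma_integral_complex'[OF assms(1)]
    unfolding f_def by (auto dest: integral_unique)
  then have *: "(\<lambda>s. \<bar>y\<bar> *\<^sub>R f (y * s)) absolutely_integrable_on {0<..} \<and>
      integral {0<..} (\<lambda>s. \<bar>y\<bar> *\<^sub>R f (y * s)) = Gamma b"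
    using assms(2)
    by (subst has_absolute_integral_change_of_variables_real[of _ "\<lambda>s. y * s"])
       (auto simp: img intro!: derivative_eq_intros inj_onI)
  define c where "c = complex_of_real y powr b"
  have c: "c \<noteq> 0" "of_real y powr (- b) = inverse c"
    using assms(2) by (auto simp: c_def powr_minus)
  have eq: "\<bar>y\<bar> *\<^sub>R f (y * s) = c * (of_real (exp (- y * s)) * of_real s powr (b - 1))" if "s \<in> {0<..}" for s
    using that assms(2)
    by (simp add: f_def c_def powr_of_real_mult powr_diff exp_minus scaleR_conv_of_real field_simps del: of_real_mult)
       (simp add: mult.commute)
  have 1: "(\<lambda>s. c * (of_real (exp (- y * s)) * of_real s powr (b - 1))) absolutely_integrable_on {0<..}"
    using set_integrable_cong[OF refl refl eq, THEN iffD1, OF _ conjunct1[OF *]] .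
  have 2: "integral {0<..} (\<lambda>s. c * (of_real (exp (- y * s)) * of_real s powr (b - 1))) = Gamma b"
    by (rule trans[OF integral_cong[OF eq [symmetric]] conjunct2[OF *]])
  from 1 show 3: "(\<lambda>s. of_real (exp (- y * s)) * of_real s powr (b - 1)) absolutely_integrable_on {0<..}"
    using c by simp
  show "integral {0<..} (\<lambda>s. of_real (exp (- y * s)) * complex_of_real s powr (b - 1)) =
           Gamma b * of_real y powr (- b)"
  proof -
    have "x = g * inverse c" if "c * x = g" for x g
      using that c(1) by (auto simp: field_simps)
    from this[of "integral {0<..} (\<lambda>s. of_real (exp (- y * s)) * complex_of_real s powr (b - 1))" "Gamma b"]
    show ?thesis unfolding c(2) using 2 by simp
  qed
qed

text \<open>Substitution t = e^(-s) turns the Beta integral over (0, 1) into a Laplace integral over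
  (0, \<infinity>).\<close>

lemma Beta_integral_exp:
  fixes a b :: complex
  assumes "Re a > 0" "Re b > 0"
  defines "h \<equiv> \<lambda>s::real. exp (- a * of_real s) * of_real (1 - exp (- s)) powr (b - 1)"
  shows "h absolutely_integrable_on {0<..}" "integral {0<..} h = Beta a b"
proof -
  define f where "f = (\<lambda>t. complex_of_real t powr (a - 1) * of_real (1 - t) powr (b - 1))"
  have img: "(\<lambda>s::real. exp (- s)) ` {0<..} = {0<..<1}"
  proof safe
    fix t :: real assume "t \<in> {0<..<1}"
    then show "t \<in> (\<lambda>s. exp (- s)) ` {0<..}"
      by (intro image_eqI[of _ _ "- ln t"]) auto
  qed auto
  have "integrable lborel (\<lambda>t. indicator {0<..<1} t *\<^sub>R f t)"
    using set_integrable_Beta_complex[OF assms(1,2)] unfolding set_integrable_def f_def .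
  then have "f absolutely_integrable_on {0<..<1}"
    unfolding set_integrable_def by (simp add: integrable_completion)
  moreover have "integral {0<..<1} f = Beta a b"
    using set_borel_integral_eq_integral(2)[OF set_integrable_Beta_complex[OF assms(1,2)]]
      lebesgue_integral_Beta_complex[OF assms(1,2)] unfolding f_def by simp
  ultimately have *: "(\<lambda>s. \<bar>- exp (- s)\<bar> *\<^sub>R f (exp (- s))) absolutely_integrable_on {0<..} \<and>
      integral {0<..} (\<lambda>s. \<bar>- exp (- s)\<bar> *\<^sub>R f (exp (- s))) = Beta a b"
    by (subst has_absolute_integral_change_of_variables_real[of _ "\<lambda>s. exp (- s)"])
       (auto simp: img intro!: derivative_eq_intros inj_onI)
  have eq: "\<bar>- exp (- s)\<bar> *\<^sub>R f (exp (- s)) = h s" if "s \<in> {0<..}" for s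
  proof -
    have "of_real (exp (- s)) * complex_of_real (exp (- s)) powr (a - 1) = complex_of_real (exp (- s)) powr a"
      by (simp add: powr_diff)
    also have "\<dots> = exp (- a * of_real s)"
      by (simp add: powr_def Ln_of_real del: of_real_exp)
    finally show ?thesis
      by (simp add: f_def h_def scaleR_conv_of_real mult.assoc [symmetric] del: of_real_exp)
  qed
  show "h absolutely_integrable_on {0<..}"
    using set_integrable_cong[OF refl refl eq, THEN iffD1, OF _ conjunct1[OF *]] .
  show "integral {0<..} h = Beta a b"
    by (rule trans[OF integral_cong[OF eq [symmetric]] conjunct2[OF *]])
qed

text \<open>Since (e^s - 1)^(-w) = e^(-w s) (1 - e^(-s))^(-w), the integral is Beta (w + k) (1 - w),
  convergent at 0 by Re w < 1 and at infinity by Re w + k > 0. The prefactor is sin (\<pi> w) /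
  \<pi>, written with \<open>rGamma\<close> so that a pole of Gamma at w does no harm.\<close>

lemma binomial_series_integral:
  fixes w :: complex
  assumes "Re w < 1" "Re w + real k > 0"
  defines "h \<equiv> \<lambda>s::real. of_real (exp (- real k * s)) * of_real (exp s - 1) powr (- w)"
  shows "h absolutely_integrable_on {0<..}"
        "rGamma w * rGamma (1 - w) * integral {0<..} h = fps_nth (binomial_series w) k"
proof -
  define h' where "h' = (\<lambda>s::real. exp (- (w + of_nat k) * of_real s) * of_real (1 - exp (- s)) powr ((1 - w) - 1))"
  have eq: "h' s = h s" if "s \<in> {0<..}" for s
  proof -
    have "exp s - 1 = exp s * (1 - exp (- s))"
      by (simp add: algebra_simps flip: exp_add)
    then have "complex_of_real (exp s - 1) powr (- w) = of_real (exp s) powr (- w) * of_real (1 - exp (- s)) powr (- w)"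
      using that powr_of_real_mult[of "exp s" "1 - exp (- s)" "- w"] by simp
    moreover have "complex_of_real (exp s) powr (- w) = exp (- w * of_real s)"
      by (simp add: powr_def Ln_of_real del: of_real_exp)
    ultimately show ?thesis
      by (simp add: h_def h'_def ring_distribs exp_diff mult.commute exp_minus_inverse
          flip: exp_of_real exp_add)
         (simp add: exp_minus divide_inverse)
  qed
  have h': "h' absolutely_integrable_on {0<..}" "integral {0<..} h' = Beta (w + of_nat k) (1 - w)"
    using Beta_integral_exp[of "w + of_nat k" "1 - w"] assms(1,2) unfolding h'_def by simp_all
  show "h absolutely_integrable_on {0<..}"
    using set_integrable_cong[OF refl refl eq, THEN iffD1, OF _ h'(1)] .
  have "integral {0<..} h = Beta (w + of_nat k) (1 - w)"
    by (rule trans[OF integral_cong[OF eq [symmetric]] h'(2)])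
  also have "\<dots> = Gamma (w + of_nat k) * Gamma (1 - w) / fact k"
    by (simp add: Beta_def Gamma_fact add.commute)
  finally have "rGamma w * rGamma (1 - w) * integral {0<..} h =
     (rGamma w * Gamma (w + of_nat k)) * (rGamma (1 - w) * Gamma (1 - w)) / fact k"
    by simp
  also have "rGamma (1 - w) * Gamma (1 - w) = 1"
    using Re_pos_not_nonpos_Int[of "1 - w"] assms(1) by (simp add: Gamma_def rGamma_eq_zero_iff)
  also have "rGamma w * Gamma (w + of_nat k) = pochhammer w k"
    using Re_pos_not_nonpos_Int[of "w + of_nat k"] assms(2)
    by (subst pochhammer_rGamma[of w k]) (simp add: Gamma_def rGamma_eq_zero_iff)
  finally show "rGamma w * rGamma (1 - w) * integral {0<..} h = fps_nth (binomial_series w) k"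
    by (simp add: binomial_series_nth)
qed

text \<open>The product is sin (\<pi> z) / \<pi>, which changes sign when z moves by one. Hence the
  Laplace representations of all terms of the expansion share one factor up to (-1)^i.\<close>

lemma rGamma_reflection_shift:
  "rGamma (z - of_nat i) * rGamma (1 - (z - of_nat i)) = (- 1) ^ i * (rGamma z * rGamma (1 - z :: complex))"
proof (induction i)
  case (Suc i)
  define w where "w = z - of_nat i"
  have 1: "rGamma (w - 1) = (w - 1) * rGamma w" "rGamma (1 - w) = (1 - w) * rGamma (1 - (w - 1))"
    using rGamma_plus1[of "w - 1"] rGamma_plus1[of "1 - w"] by (simp_all add: algebra_simps)
  have 2: "(w - 1) * x * y = - (x * ((1 - w) * y))" for x y
    by (simp add: algebra_simps)
  have "rGamma (w - 1) * rGamma (1 - (w - 1)) = - (rGamma w * rGamma (1 - w))"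
    unfolding 1 by (rule 2)
  moreover have "z - of_nat (Suc i) = w - 1"
    by (simp add: w_def)
  ultimately show ?case
    using Suc.IH unfolding w_def [symmetric] by (simp only: power_Suc) simp
qed simp

lemma norm_of_real_powr:
  assumes "x > 0"
  shows "norm (complex_of_real x powr c) = x powr Re c"
  using assms by (simp add: norm_powr_real_powr)

text \<open>
  Up to the common factor \<open>sin (\<pi> z) / \<pi>\<close>, the numbers \<open>(k + \<tau>)\<^sup>z\<^sup>-\<^sup>1 / \<Gamma>(z)\<close> and the \<open>k\<close>-th coefficient of
  \<open>(1 - \<xi>)\<^sup>i\<^sup>-\<^sup>z\<close> are, for \<open>Re z < 1\<close>, the Laplace transforms at \<open>k\<close> of \<open>e\<^sup>-\<^sup>\<tau>\<^sup>s s\<^sup>-\<^sup>z\<close> and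
  \<open>(-1)\<^sup>i (e\<^sup>s - 1)\<^sup>i\<^sup>-\<^sup>z\<close>. The former expands in the latter by Taylor's formula for the symbol at
  \<open>\<xi> = e\<^sup>s\<close>, and a difference of order \<open>s\<^sup>M\<^sup>-\<^sup>z\<close> at \<open>0\<close> transforms to one of order \<open>k\<^sup>z\<^sup>-\<^sup>1\<^sup>-\<^sup>M\<close>.
\<close>
lemma remainder_kernel_bound:
  fixes z :: complex
  assumes z: "Re z < 1" and M: "M > 0"
  defines "q \<equiv> real M - Re z"
  obtains C where "C > 0"
    "\<And>\<tau> s. \<bar>\<tau>\<bar> \<le> T \<Longrightarrow> s > 0 \<Longrightarrow>
       norm (of_real (exp (- \<tau> * s)) * of_real s powr (- z) -
         (\<Sum>i<M. fps_nth (symbol_fps z (- \<tau>)) i * ((- 1) ^ i * of_real (exp s - 1) powr (of_nat i - z))))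
       \<le> C * (s powr q * exp ((T + q) * s))"
proof -
  obtain B where B: "B > 0"
    "\<And>\<theta> i. \<bar>\<theta>\<bar> \<le> T \<Longrightarrow> norm (fps_nth (symbol_fps z \<theta>) i) \<le> B * 3 ^ i"
    "\<And>\<theta> u M. \<bar>\<theta>\<bar> \<le> T \<Longrightarrow> norm u \<le> 1 / 6 \<Longrightarrow>
      norm (SCQ_symbol z \<theta> (1 - u) - (\<Sum>i<M. fps_nth (symbol_fps z \<theta>) i * u ^ i)) \<le> 2 * B * (3 * norm u) ^ M"
    using symbol_fps_bounds[of T z] by blast
  \<comment> \<open>\<open>C1\<close> serves small s, through the Taylor remainder;
    \<open>C2\<close> serves large s, where all terms are estimated separately.\<close>
  define C1 where "C1 = 2 * B * 3 ^ M"
  define C2 where "C2 = 8 ^ M * (1 + (\<Sum>i<M. B * 3 ^ i))"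
  have q: "q \<ge> 0" using z M by (simp add: q_def)
  have "(\<Sum>i<M. B * 3 ^ i) \<ge> 0" using B(1) by (intro sum_nonneg) simp
  then have C12: "C1 > 0" "C2 > 0" using B(1) by (simp_all add: C1_def C2_def)
  have "norm (of_real (exp (- \<tau> * s)) * of_real s powr (- z) -
         (\<Sum>i<M. fps_nth (symbol_fps z (- \<tau>)) i * ((- 1) ^ i * of_real (exp s - 1) powr (of_nat i - z))))
       \<le> (C1 + C2) * (s powr q * exp ((T + q) * s))"
    if \<tau>: "\<bar>\<tau>\<bar> \<le> T" and s: "s > 0" for \<tau> s
  proof -
    define w where "w = exp s - 1"
    define E where "E = fps_nth (symbol_fps z (- \<tau>))"
    have w: "w > 0" "s \<le> w"
      using s exp_ge_add_one_self[of s] by (simp_all add: w_def del: exp_ge_add_one_self)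
    have "1 - s \<le> exp (- s)"
      using exp_ge_add_one_self[of "- s"] by simp
    then have "exp s * (1 - s) \<le> exp s * exp (- s)"
      by (rule mult_left_mono) simp
    also have "exp s * exp (- s) = 1"
      by (simp flip: exp_add)
    \<comment> \<open>Together with s <= w this makes powers of w and s interchangeable at the price
      of an exponential factor.\<close>
    finally have "w \<le> s * exp s"
      by (simp add: w_def algebra_simps)
    then have "w powr q \<le> (s * exp s) powr q"
      using w q by (intro powr_mono2) auto
    then have wq: "w powr q \<le> s powr q * exp (q * s)"
      using s by (simp add: powr_mult) (simp add: powr_def)
    have T: "T \<ge> 0" using \<tau> by simp
    have "- \<tau> * s \<le> T * s"
      using s \<tau> by (intro mult_right_mono) auto
    then have eTs: "1 \<le> exp (T * s)" "exp (- \<tau> * s) \<le> exp (T * s)"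
      using T s by simp_all
    have pw: "of_real w powr (of_nat i - z) = of_real w ^ i * of_real w powr (- z)" for i
      using w by (simp add: powr_diff powr_minus powr_nat divide_inverse)
    let ?W = "of_real (exp (- \<tau> * s)) * complex_of_real s powr (- z) -
         (\<Sum>i<M. E i * ((- 1) ^ i * of_real w powr (of_nat i - z)))"
    have main: "norm ?W \<le> (C1 + C2) * (w powr q * exp (T * s))"
    proof (cases "s \<le> 1 / 8")
      case True
      \<comment> \<open>For s <= 1/8 the point u = -w satisfies norm u <= 1/6, where the Taylor
        remainder is controlled; there \<xi> = e^s and log_ratio u = s / w.\<close>
      have "exp s \<le> 1 + s + s ^ 2"
        using True s by (intro exp_bound) auto
      also have "s ^ 2 \<le> (1 / 8) ^ 2"
        using True s by (intro power_mono) auto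
      finally have w6: "w \<le> 1 / 6"
        using True by (simp add: w_def power2_eq_square)
      have 1: "1 - - complex_of_real w = of_real (exp s)"
        by (simp add: w_def)
      moreover have "log_ratio (- of_real w) = of_real (s / w)"
        unfolding log_ratio_def 1 using w by (simp add: Ln_of_real del: of_real_exp)
      moreover have "complex_of_real (exp s) powr of_real (- \<tau>) = of_real (exp s powr (- \<tau>))"
        by (rule powr_of_real) simp
      then have "complex_of_real (exp s) powr of_real (- \<tau>) = of_real (exp (- \<tau> * s))"
        by (simp add: powr_def)
      ultimately have "SCQ_symbol z (- \<tau>) (1 - - of_real w) =
          of_real (exp (- \<tau> * s)) * of_real (s / w) powr (- z)"
        unfolding SCQ_symbol_log_ratio by simp
      moreover have "of_real s powr (- z) = of_real (s / w) powr (- z) * of_real w powr (- z)"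
        using w s powr_of_real_mult[of "s / w" w "- z"] by simp
      ultimately have "?W = of_real w powr (- z) *
         (SCQ_symbol z (- \<tau>) (1 - - of_real w) - (\<Sum>i<M. E i * (- of_real w) ^ i))"
        by (simp add: pw right_diff_distrib sum_distrib_left mult_ac power_minus[of "of_real w"])
      also have "norm \<dots> \<le> w powr (- Re z) * (2 * B * (3 * norm (- complex_of_real w)) ^ M)"
        unfolding norm_mult E_def using w w6 \<tau>
        by (intro mult_mono B(3)) (auto simp: norm_of_real_powr)
      also have "\<dots> = C1 * (w powr q * 1)"
        using w by (simp add: C1_def q_def power_mult_distrib powr_diff powr_minus powr_realpow field_simps)
      also have "\<dots> \<le> (C1 + C2) * (w powr q * exp (T * s))"
        using C12 eTs by (intro mult_mono) auto
      finally show ?thesis .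
    next
      case False
      have e8: "x powr (- Re z + real i) \<le> 8 ^ M * x powr q" if "x \<ge> 1 / 8" "i \<le> M" for x i
      proof -
        have "x powr (- Re z + real i) = x powr (- real (M - i)) * x powr q"
          using that by (simp add: q_def of_nat_diff flip: powr_add)
        also have "x powr (- real (M - i)) \<le> (1 / 8) powr (- real (M - i))"
          using that by (intro powr_mono2') auto
        also have "(1 / 8 :: real) powr (- real (M - i)) = 8 ^ (M - i)"
          by (simp add: powr_minus powr_realpow power_one_over)
        also have "(8::real) ^ (M - i) \<le> 8 ^ M"
          by (intro power_increasing) auto
        finally show ?thesis by (simp add: mult_right_mono)
      qed
      have "norm ?W \<le> exp (- \<tau> * s) * s powr (- Re z) + (\<Sum>i<M. norm (E i) * w powr (- Re z + real i))"
        using s w by (intro norm_triangle_le_diff add_mono sum_norm_le)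
          (auto simp: norm_mult norm_power norm_of_real_powr algebra_simps)
      also have "\<dots> \<le> exp (T * s) * (8 ^ M * w powr q) + (\<Sum>i<M. (B * 3 ^ i) * (8 ^ M * w powr q))"
      proof (intro add_mono sum_mono mult_mono)
        have "s powr (- Re z) \<le> 8 ^ M * s powr q"
          using e8[of s 0] False by simp
        also have "s powr q \<le> w powr q"
          using s w q by (intro powr_mono2) auto
        finally show "s powr (- Re z) \<le> 8 ^ M * w powr q" by simp
        show "norm (E i) \<le> B * 3 ^ i" for i
          unfolding E_def using \<tau> by (intro B(2)) simp
        show "w powr (- Re z + real i) \<le> 8 ^ M * w powr q" if "i \<in> {..<M}" for i
          using that w False by (intro e8) auto
      qed (use eTs B(1) in auto)
      also have "\<dots> \<le> exp (T * s) * (8 ^ M * w powr q) + exp (T * s) * (\<Sum>i<M. (B * 3 ^ i) * (8 ^ M * w powr q))"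
      proof (rule add_left_mono)
        have "0 \<le> (\<Sum>i<M. (B * 3 ^ i) * (8 ^ M * w powr q))"
          using B(1) by (intro sum_nonneg) simp
        from mult_right_mono[OF eTs(1) this]
        show "(\<Sum>i<M. (B * 3 ^ i) * (8 ^ M * w powr q)) \<le>
            exp (T * s) * (\<Sum>i<M. (B * 3 ^ i) * (8 ^ M * w powr q))"
          by simp
      qed
      also have "\<dots> = C2 * (w powr q * exp (T * s))"
        by (simp add: C2_def algebra_simps sum_distrib_left sum_distrib_right)
      also have "\<dots> \<le> (C1 + C2) * (w powr q * exp (T * s))"
        using C12 by (intro mult_right_mono) auto
      finally show ?thesis .
    qed
    also have "\<dots> \<le> (C1 + C2) * ((s powr q * exp (q * s)) * exp (T * s))"
      using C12 wq by (intro mult_left_mono mult_right_mono) auto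
    also have "\<dots> = (C1 + C2) * (s powr q * (exp (T * s) * exp (q * s)))"
      by (simp only: mult_ac)
    also have "exp (T * s) * exp (q * s) = exp ((T + q) * s)"
      by (subst distrib_right) (rule exp_add [symmetric])
    finally show ?thesis unfolding E_def w_def .
  qed
  moreover have "C1 + C2 > 0" using C12 by simp
  ultimately show ?thesis using that by blast
qed

subsection \<open>Asymptotic expansion of shifted powers\<close>

lemma absolutely_integrable_has_integral:
  fixes f :: "real \<Rightarrow> complex"
  assumes "f absolutely_integrable_on S" "integral S f = I"
  shows "(f has_integral I) S"
  using set_lebesgue_integral_eq_integral(1)[OF assms(1)] assms(2) integrable_integral by fast

lemma has_integral_Gamma_scaled_real:
  fixes q y :: real
  assumes "q > - 1" "y > 0"
  shows "((\<lambda>s. s powr q * exp (- y * s)) has_integral Gamma (q + 1) * y powr (- (q + 1))) {0<..}"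
proof -
  let ?b = "complex_of_real (q + 1)"
  let ?f = "\<lambda>s. of_real (exp (- y * s)) * complex_of_real s powr (?b - 1)"
  have "Re ?b > 0" using assms(1) by simp
  note G = Gamma_integral_scaled[OF this assms(2)]
  have "(?f has_integral Gamma ?b * of_real y powr (- ?b)) {0<..}"
    by (rule absolutely_integrable_has_integral[OF G])
  also have "Gamma ?b * complex_of_real y powr (- ?b) = of_real (Gamma (q + 1) * y powr (- (q + 1)))"
    using assms(2) powr_of_real[of y "- (q + 1)"] Gamma_complex_of_real[of "q + 1"] by simp
  finally have *: "(?f has_integral of_real (Gamma (q + 1) * y powr (- (q + 1)))) {0<..}" .
  have "((\<lambda>s. Re (?f s)) has_integral Gamma (q + 1) * y powr (- (q + 1))) {0<..}"
    using has_integral_Re[OF *] unfolding Re_complex_of_real .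
  then show ?thesis
  proof (rule has_integral_eq[rotated])
    fix s :: real assume "s \<in> {0<..}"
    then have "complex_of_real s powr of_real q = of_real (s powr q)"
      by (intro powr_of_real) simp
    then have "?f s = of_real (s powr q * exp (- y * s))"
      by simp
    then show "Re (?f s) = s powr q * exp (- y * s)"
      by (simp only: Re_complex_of_real)
  qed
qed

text \<open>The shift enters as -\<tau> because the symbol with this shift contributes e^(-\<tau> s)
  at \<xi> = e^s, which in the Laplace integral moves k to k + \<tau>.\<close>

definition power_remainder :: "complex \<Rightarrow> nat \<Rightarrow> real \<Rightarrow> nat \<Rightarrow> complex" where
  "power_remainder z M \<tau> k = rGamma z * of_real (real k + \<tau>) powr (z - 1) -
     (\<Sum>i<M. fps_nth (symbol_fps z (- \<tau>)) i * fps_nth (binomial_series (z - of_nat i)) k)"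

text \<open>The constants come before \<tau>, because the offset of the grid from 0 varies with h.
  The threshold K leaves out small k, for which k + \<tau> may be zero or negative.\<close>

definition power_expansion :: "complex \<Rightarrow> bool" where
  "power_expansion z \<longleftrightarrow> (\<forall>T. \<forall>M>0. \<exists>C>0. \<exists>K. \<forall>\<tau> k. \<bar>\<tau>\<bar> \<le> T \<longrightarrow> k \<ge> K \<longrightarrow>
     norm (power_remainder z M \<tau> k) \<le> C * (real k + 1) powr (Re z - 1 - real M))"

lemma power_expansion_base:
  assumes z: "Re z < 1"
  shows "power_expansion z"
  unfolding power_expansion_def power_remainder_def
proof (intro allI impI)
  fix T :: real and M :: nat
  assume M: "M > 0"
  define q where "q = real M - Re z"
  define D where "D = \<bar>T\<bar> + q"
  obtain C where C: "C > 0"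
    "\<And>\<tau> s. \<bar>\<tau>\<bar> \<le> \<bar>T\<bar> \<Longrightarrow> s > 0 \<Longrightarrow>
       norm (of_real (exp (- \<tau> * s)) * of_real s powr (- z) -
         (\<Sum>i<M. fps_nth (symbol_fps z (- \<tau>)) i * ((- 1) ^ i * of_real (exp s - 1) powr (of_nat i - z))))
       \<le> C * (s powr q * exp (D * s))"
    using remainder_kernel_bound[OF z M, of "\<bar>T\<bar>"] unfolding q_def D_def by blast
  \<comment> \<open>This is sin (\<pi> z) / \<pi>, the factor common to all Laplace representations.
    It vanishes at integers, hence the norm of \<kappa> plus 1 in the positive constant
    \<open>C'\<close>.\<close>
  define \<kappa> where "\<kappa> = rGamma z * rGamma (1 - z)"
  define C' where "C' = (norm \<kappa> + 1) * (C * (Gamma (q + 1) * 2 powr (q + 1)))"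
  have q: "q > 0" using z M by (simp add: q_def)
  have D: "D \<ge> q" by (simp add: D_def)
  have C': "C' > 0" using q C(1) by (simp add: C'_def add_nonneg_pos)
  \<comment> \<open>From k >= 2 D + 1 follow k - D >= (k + 1) / 2, positivity of k + \<tau>, and
    convergence of all Laplace integrals below.\<close>
  obtain K :: nat where K: "real K \<ge> 2 * D + 1"
    using real_arch_simple by blast
  have "norm (rGamma z * of_real (real k + \<tau>) powr (z - 1) -
       (\<Sum>i<M. fps_nth (symbol_fps z (- \<tau>)) i * fps_nth (binomial_series (z - of_nat i)) k))
     \<le> C' * (real k + 1) powr (Re z - 1 - real M)"
    if \<tau>: "\<bar>\<tau>\<bar> \<le> T" and k: "k \<ge> K" for \<tau> k
  proof -
    have kD: "real k \<ge> 2 * D + 1" using k K by linarith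
    define y where "y = real k + \<tau>"
    have y: "y > 0" using kD \<tau> q by (simp add: y_def D_def)
    define E where "E = fps_nth (symbol_fps z (- \<tau>))"
    define f0 where "f0 = (\<lambda>s. of_real (exp (- y * s)) * complex_of_real s powr ((1 - z) - 1))"
    define f where "f = (\<lambda>i s. of_real (exp (- real k * s)) * complex_of_real (exp s - 1) powr (- (z - of_nat i)))"
    define W where "W = (\<lambda>s. f0 s - (\<Sum>i<M. E i * ((- 1) ^ i * f i s)))"
    have "Re (1 - z) > 0" using z by simp
    note G = Gamma_integral_scaled[OF this y, folded f0_def]
    have f0: "(f0 has_integral Gamma (1 - z) * of_real y powr (z - 1)) {0<..}"
      using absolutely_integrable_has_integral[OF G] by simp
    have fi: "(f i has_integral integral {0<..} (f i)) {0<..}"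
      "rGamma (z - of_nat i) * rGamma (1 - (z - of_nat i)) * integral {0<..} (f i) =
         fps_nth (binomial_series (z - of_nat i)) k" if "i < M" for i
    proof -
      have "Re (z - of_nat i) < 1" "Re (z - of_nat i) + real k > 0"
        using z that kD D q by (auto simp: q_def)
      note S = binomial_series_integral[OF this]
      show "(f i has_integral integral {0<..} (f i)) {0<..}"
        unfolding f_def by (rule absolutely_integrable_has_integral[OF S(1) refl])
      show "rGamma (z - of_nat i) * rGamma (1 - (z - of_nat i)) * integral {0<..} (f i) =
         fps_nth (binomial_series (z - of_nat i)) k"
        unfolding f_def by (rule S(2))
    qed
    define J where "J = Gamma (1 - z) * of_real y powr (z - 1) -
      (\<Sum>i<M. E i * ((- 1) ^ i * integral {0<..} (f i)))"
    have WJ: "(W has_integral J) {0<..}"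
      unfolding W_def J_def
      by (intro has_integral_diff f0 has_integral_sum has_integral_mult_right fi) auto
    have "\<kappa> * J = rGamma z * (rGamma (1 - z) * Gamma (1 - z)) * of_real y powr (z - 1) -
      (\<Sum>i<M. E i * (((- 1) ^ i * \<kappa>) * integral {0<..} (f i)))"
      by (simp add: J_def \<kappa>_def right_diff_distrib sum_distrib_left mult_ac)
    also have "rGamma (1 - z) * Gamma (1 - z) = 1"
      using Re_pos_not_nonpos_Int[of "1 - z"] z by (simp add: Gamma_def rGamma_eq_zero_iff)
    also have "(\<Sum>i<M. E i * (((- 1) ^ i * \<kappa>) * integral {0<..} (f i))) =
        (\<Sum>i<M. E i * fps_nth (binomial_series (z - of_nat i)) k)"
      using fi(2) by (intro sum.cong refl) (simp add: \<kappa>_def flip: rGamma_reflection_shift)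
    finally have \<kappa>J: "\<kappa> * J = rGamma z * of_real y powr (z - 1) -
        (\<Sum>i<M. E i * fps_nth (binomial_series (z - of_nat i)) k)"
      by simp
    have kD': "real k - D > 0" using kD D q by simp
    note g = has_integral_Gamma_scaled_real[of q "real k - D", OF _ kD', THEN has_integral_mult_right[of _ _ _ C]]
    have "norm (integral {0<..} W) \<le> integral {0<..} (\<lambda>s. C * (s powr q * exp (- (real k - D) * s)))"
    proof (rule integral_norm_bound_integral)
      show "W integrable_on {0<..}" using WJ by blast
      show "(\<lambda>s. C * (s powr q * exp (- (real k - D) * s))) integrable_on {0<..}"
        using g q by (meson has_integral_integrable less_trans neg_less_0_iff_less zero_less_one)
      fix s :: real assume "s \<in> {0<..}"
      then have s: "s > 0" by simp
      have "W s = of_real (exp (- real k * s)) * (of_real (exp (- \<tau> * s)) * of_real s powr (- z) -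
         (\<Sum>i<M. E i * ((- 1) ^ i * of_real (exp s - 1) powr (of_nat i - z))))"
      proof -
        have "exp (- y * s) = exp (- real k * s) * exp (- \<tau> * s)"
          by (simp add: y_def algebra_simps flip: exp_add)
        then show ?thesis
          by (simp add: W_def f0_def f_def right_diff_distrib sum_distrib_left mult_ac)
      qed
      then have "norm (W s) = exp (- real k * s) * norm (of_real (exp (- \<tau> * s)) * of_real s powr (- z) -
         (\<Sum>i<M. E i * ((- 1) ^ i * of_real (exp s - 1) powr (of_nat i - z))))"
        by (simp only: norm_mult norm_of_real abs_exp_cancel)
      also have "\<dots> \<le> exp (- real k * s) * (C * (s powr q * exp (D * s)))"
        unfolding E_def using \<tau> s by (intro mult_left_mono C(2)) auto
      also have "\<dots> = C * (s powr q * (exp (- real k * s) * exp (D * s)))"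
        by (simp only: mult_ac)
      also have "exp (- real k * s) * exp (D * s) = exp (- (real k - D) * s)"
        by (simp add: algebra_simps flip: exp_add)
      finally show "norm (W s) \<le> C * (s powr q * exp (- (real k - D) * s))" .
    qed
    also have "\<dots> = C * (Gamma (q + 1) * (real k - D) powr (- (q + 1)))"
      using g q by (intro integral_unique) auto
    also have "\<dots> \<le> C * (Gamma (q + 1) * ((real k + 1) / 2) powr (- (q + 1)))"
      using C(1) q kD D by (intro mult_left_mono powr_mono2') (auto intro: Gamma_real_nonneg)
    also have "((real k + 1) / 2) powr (- (q + 1)) = 2 powr (q + 1) * (real k + 1) powr (- (q + 1))"
      unfolding powr_minus by (simp add: powr_divide) (simp add: divide_inverse)
    finally have "norm J \<le> C * (Gamma (q + 1) * 2 powr (q + 1)) * (real k + 1) powr (- (q + 1))"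
      unfolding integral_unique[OF WJ] by (simp only: mult.assoc)
    then have "norm (\<kappa> * J) \<le> (norm \<kappa> + 1) * (C * (Gamma (q + 1) * 2 powr (q + 1)) * (real k + 1) powr (- (q + 1)))"
      unfolding norm_mult by (intro mult_mono) auto
    also have "\<dots> = C' * (real k + 1) powr (- (q + 1))"
      by (simp add: C'_def mult_ac)
    also have "- (q + 1) = Re z - 1 - real M"
      by (simp add: q_def)
    finally show ?thesis
      unfolding \<kappa>J y_def E_def .
  qed
  with C' show "\<exists>C>0. \<exists>K. \<forall>\<tau> k. \<bar>\<tau>\<bar> \<le> T \<longrightarrow> k \<ge> K \<longrightarrow>
     norm (rGamma z * of_real (real k + \<tau>) powr (z - 1) -
       (\<Sum>i<M. fps_nth (symbol_fps z (- \<tau>)) i * fps_nth (binomial_series (z - of_nat i)) k))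
     \<le> C * (real k + 1) powr (Re z - 1 - real M)"
    by blast
qed

text \<open>The recurrence carries a factor z and cannot pass from 0 to 1. At z = 1 the terms with i
  > 0 are coefficients of the polynomials (1 - \<xi>)^(i - 1), which vanish once k >= M, so the
  remainder is exactly 0. The case k + \<tau> = 0 is kept out since \<open>0 powr 0\<close> is
  0.\<close>

lemma power_expansion_one: "power_expansion 1"
  unfolding power_expansion_def power_remainder_def
proof (intro allI impI)
  fix T :: real and M :: nat
  assume M: "M > 0"
  obtain K0 :: nat where K0: "real K0 \<ge> \<bar>T\<bar> + 1"
    using real_arch_simple by blast
  have "rGamma 1 * of_real (real k + \<tau>) powr (1 - 1) -
       (\<Sum>i<M. fps_nth (symbol_fps 1 (- \<tau>)) i * fps_nth (binomial_series (1 - of_nat i)) k) = 0"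
    if "\<bar>\<tau>\<bar> \<le> T" "k \<ge> max K0 M" for \<tau> k
  proof -
    have "real k + \<tau> \<noteq> 0" using that K0 by auto
    then have "complex_of_real (real k + \<tau>) \<noteq> 0" unfolding of_real_eq_0_iff .
    moreover have "fps_nth (binomial_series (1 - of_nat i)) k = (if i = 0 then 1 else 0)" if "i < M" for i
    proof (cases i)
      case (Suc n)
      then have "n < k" using that \<open>k \<ge> max K0 M\<close> by simp
      then have "pochhammer (- of_nat n :: complex) k = 0"
        by (rule pochhammer_of_nat_eq_0_lemma)
      then show ?thesis using Suc by (simp add: binomial_series_nth)
    qed (simp add: binomial_series_nth flip: pochhammer_fact)
    then have "(\<Sum>i<M. fps_nth (symbol_fps 1 (- \<tau>)) i * fps_nth (binomial_series (1 - of_nat i)) k) =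
      (\<Sum>i<M. if i = 0 then fps_nth (symbol_fps 1 (- \<tau>)) 0 else 0)"
      by (intro sum.cong) auto
    then have "(\<Sum>i<M. fps_nth (symbol_fps 1 (- \<tau>)) i * fps_nth (binomial_series (1 - of_nat i)) k) = 1"
      using M by simp
    ultimately show ?thesis by simp
  qed
  then show "\<exists>C>0. \<exists>K. \<forall>\<tau> k. \<bar>\<tau>\<bar> \<le> T \<longrightarrow> k \<ge> K \<longrightarrow>
     norm (rGamma 1 * of_real (real k + \<tau>) powr (1 - 1) -
       (\<Sum>i<M. fps_nth (symbol_fps 1 (- \<tau>)) i * fps_nth (binomial_series (1 - of_nat i)) k))
     \<le> C * (real k + 1) powr (Re 1 - 1 - real M)"
    by (intro exI[of _ 1] conjI exI[of _ "max K0 M"] allI impI) simp_all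
qed

text \<open>Both sides are pochhammer a (k + 1) / k!. This converts multiplication by k into raising
  the exponent.\<close>

lemma binomial_series_nth_rec:
  "(of_nat k + a) * fps_nth (binomial_series a) k = a * fps_nth (binomial_series (a + 1)) k"
proof -
  have "a * pochhammer (a + 1) k = pochhammer a k * (a + of_nat k)"
    by (simp flip: pochhammer_rec pochhammer_Suc)
  then show ?thesis by (simp add: binomial_series_nth field_simps)
qed

lemma symbol_fps_nth_recurrence:
  "z * fps_nth (symbol_fps (z + 1) (- \<tau>)) 0 = z * fps_nth (symbol_fps z (- \<tau>)) 0"
  "z * fps_nth (symbol_fps (z + 1) (- \<tau>)) (Suc i) =
     (z - of_nat (Suc i)) * fps_nth (symbol_fps z (- \<tau>)) (Suc i) +
     (of_real \<tau> - z + of_nat i) * fps_nth (symbol_fps z (- \<tau>)) i"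
proof -
  define F where "F = symbol_fps z (- \<tau>)"
  have *: "fps_const z * symbol_fps (z + 1) (- \<tau>) =
     fps_const z * F - fps_X * (fps_const (z - of_real \<tau>) * F) - fps_X * fps_deriv F + fps_X * (fps_X * fps_deriv F)"
    using symbol_fps_recurrence[of z "- \<tau>"] by (simp add: F_def algebra_simps)
  show "z * fps_nth (symbol_fps (z + 1) (- \<tau>)) 0 = z * fps_nth (symbol_fps z (- \<tau>)) 0"
    using arg_cong[OF *, of "\<lambda>f. fps_nth f 0"] by (simp add: F_def)
  show "z * fps_nth (symbol_fps (z + 1) (- \<tau>)) (Suc i) =
     (z - of_nat (Suc i)) * fps_nth (symbol_fps z (- \<tau>)) (Suc i) +
     (of_real \<tau> - z + of_nat i) * fps_nth (symbol_fps z (- \<tau>)) i"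
    using arg_cong[OF *, of "\<lambda>f. fps_nth f (Suc i)"]
    by (cases i) (simp_all add: F_def algebra_simps)
qed

lemma symbol_fps_nth_bound:
  obtains B where "B > 0"
    "\<And>\<theta> i. \<bar>\<theta>\<bar> \<le> T \<Longrightarrow> norm (fps_nth (symbol_fps z \<theta>) i) \<le> B * 3 ^ i"
  by (rule symbol_fps_bounds[of T z]) (rule that)

text \<open>Multiply the expansion for z by y = k + \<tau>. Each y * c_k(z - i) splits into
  multiples of c_k(z + 1 - i) and c_k(z - i), and the collected coefficients are those for z + 1, up
  to the factor z. One last term is left over, of the order of the new remainder.\<close>

lemma power_expansion_step:
  assumes z: "z \<noteq> 0" and P: "power_expansion z"
  shows "power_expansion (z + 1)"
  unfolding power_expansion_def power_remainder_def
proof (intro allI impI)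
  fix T :: real and M :: nat
  assume M: "M > 0"
  then obtain N where N: "M = Suc N" by (cases M) auto
  obtain C K where C: "C > 0" and K: "\<And>\<tau> k. \<bar>\<tau>\<bar> \<le> T \<Longrightarrow> k \<ge> K \<Longrightarrow>
     norm (power_remainder z M \<tau> k) \<le> C * (real k + 1) powr (Re z - 1 - real M)"
    using P M unfolding power_expansion_def by blast
  obtain B where B: "B > 0"
    "\<And>\<theta> i. \<bar>\<theta>\<bar> \<le> T \<Longrightarrow> norm (fps_nth (symbol_fps z \<theta>) i) \<le> B * 3 ^ i"
    by (rule symbol_fps_nth_bound[of T z]) (rule that)
  obtain A where A: "A > 0"
    "\<And>k. norm (fps_nth (binomial_series (z - of_nat N)) k) \<le> A * (real k + 1) powr (Re (z - of_nat N) - 1)"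
    by (rule binomial_series_nth_bound[of "z - of_nat N"]) (rule that)
  obtain K0 :: nat where K0: "real K0 \<ge> \<bar>T\<bar> + 1"
    using real_arch_simple by blast
  define C' where "C' = ((1 + \<bar>T\<bar>) * C + (\<bar>T\<bar> + norm z + real N) * (B * 3 ^ N) * A) / norm z"
  have C': "C' > 0"
    using z C B(1) A(1) by (auto simp: C'_def intro!: divide_pos_pos add_pos_nonneg)
  have "norm (rGamma (z + 1) * of_real (real k + \<tau>) powr (z + 1 - 1) -
       (\<Sum>i<M. fps_nth (symbol_fps (z + 1) (- \<tau>)) i * fps_nth (binomial_series (z + 1 - of_nat i)) k))
     \<le> C' * (real k + 1) powr (Re (z + 1) - 1 - real M)"
    if \<tau>: "\<bar>\<tau>\<bar> \<le> T" and k: "k \<ge> max K K0" for \<tau> k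
  proof -
    define y where "y = real k + \<tau>"
    have y: "y > 0" "y \<le> (1 + \<bar>T\<bar>) * (real k + 1)"
      using \<tau> k K0 by (auto simp: y_def algebra_simps intro: order_trans[of _ "\<bar>T\<bar>"] mult_nonneg_nonneg)
    define E where "E = fps_nth (symbol_fps z (- \<tau>))"
    define E' where "E' = fps_nth (symbol_fps (z + 1) (- \<tau>))"
    define H where "H = (\<lambda>i. fps_nth (binomial_series (z + 1 - of_nat i)) k)"
    define c where "c = (\<lambda>i. of_real \<tau> - z + of_nat i :: complex)"
    define R where "R = rGamma z * of_real y powr (z - 1) - (\<Sum>i<M. E i * H (Suc i))"
    have H: "of_real y * H (Suc i) = (z - of_nat i) * H i + c i * H (Suc i)" for i
      using binomial_series_nth_rec[of k "z - of_nat i"]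
      by (simp add: H_def c_def y_def algebra_simps)
    have "z * (rGamma (z + 1) * of_real y powr (z + 1 - 1) - (\<Sum>i<M. E' i * H i)) =
        rGamma z * of_real y powr z - (\<Sum>i<M. (z * E' i) * H i)"
      unfolding right_diff_distrib sum_distrib_left mult.assoc [symmetric] rGamma_plus1 by simp
    also have "of_real y powr z = of_real y * complex_of_real y powr (z - 1)"
      using y by (simp add: powr_diff)
    \<comment> \<open>The second sum stops at N = M - 1 because the recurrence for coefficient i + 1
      refers back to i. The missing summand i = N is the leftover term.\<close>
    also have "(\<Sum>i<M. (z * E' i) * H i) =
       (\<Sum>i<M. (z - of_nat i) * E i * H i) + (\<Sum>i<N. c i * E i * H (Suc i))"
      unfolding N sum.lessThan_Suc_shift
      by (simp add: E'_def E_def c_def symbol_fps_nth_recurrence distrib_right sum.distrib)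
    also have "rGamma z * (of_real y * complex_of_real y powr (z - 1)) -
       ((\<Sum>i<M. (z - of_nat i) * E i * H i) + (\<Sum>i<N. c i * E i * H (Suc i))) =
       of_real y * R + c N * E N * H (Suc N)"
    proof -
      have "of_real y * (\<Sum>i<M. E i * H (Suc i)) = (\<Sum>i<M. E i * (of_real y * H (Suc i)))"
        by (simp add: sum_distrib_left mult_ac)
      also have "\<dots> = (\<Sum>i<M. (z - of_nat i) * E i * H i) + (\<Sum>i<M. c i * E i * H (Suc i))"
        unfolding H distrib_left sum.distrib by (simp add: mult_ac)
      also have "(\<Sum>i<M. c i * E i * H (Suc i)) = (\<Sum>i<N. c i * E i * H (Suc i)) + c N * E N * H (Suc N)"
        by (simp add: N)
      finally show ?thesis
        unfolding R_def right_diff_distrib by (simp add: mult_ac)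
    qed
    finally have eq: "z * (rGamma (z + 1) * of_real y powr (z + 1 - 1) - (\<Sum>i<M. E' i * H i)) =
       of_real y * R + c N * E N * H (Suc N)" .
    define p where "p = (real k + 1) powr (Re z - real M)"
    have "norm R \<le> C * (real k + 1) powr (Re z - 1 - real M)"
      using K[of \<tau> k] \<tau> k by (simp add: power_remainder_def R_def y_def E_def H_def algebra_simps)
    then have "y * norm R \<le> ((1 + \<bar>T\<bar>) * (real k + 1)) * (C * (real k + 1) powr (Re z - 1 - real M))"
      using y by (intro mult_mono) auto
    also have "\<dots> = (1 + \<bar>T\<bar>) * C * ((real k + 1) * (real k + 1) powr (Re z - 1 - real M))"
      by (simp only: mult_ac)
    also have "(real k + 1) * (real k + 1) powr (Re z - 1 - real M) = (real k + 1) powr (1 + (Re z - 1 - real M))"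
      unfolding powr_add by simp
    also have "\<dots> = p" by (simp add: p_def algebra_simps)
    finally have 1: "norm (of_real y * R) \<le> (1 + \<bar>T\<bar>) * C * p"
      using y by (simp add: norm_mult)
    have "norm (c N) \<le> \<bar>T\<bar> + norm z + real N"
    proof -
      have "norm (c N) \<le> norm (complex_of_real \<tau>) + norm z + norm (of_nat N :: complex)"
        unfolding c_def by (rule order_trans[OF norm_triangle_ineq add_right_mono[OF norm_triangle_ineq4]])
      then show ?thesis using \<tau> by simp
    qed
    moreover have "norm (E N) \<le> B * 3 ^ N"
      unfolding E_def using \<tau> by (intro B) simp
    moreover have "norm (H (Suc N)) \<le> A * p"
      using A(2)[of k] by (simp add: H_def p_def N algebra_simps)
    ultimately have 2: "norm (c N * E N * H (Suc N)) \<le> (\<bar>T\<bar> + norm z + real N) * (B * 3 ^ N) * (A * p)"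
      unfolding norm_mult using B(1) by (intro mult_mono) auto
    have "norm z * norm (rGamma (z + 1) * of_real y powr (z + 1 - 1) - (\<Sum>i<M. E' i * H i)) =
      norm (of_real y * R + c N * E N * H (Suc N))"
      unfolding eq [symmetric] norm_mult ..
    also have "\<dots> \<le> (1 + \<bar>T\<bar>) * C * p + (\<bar>T\<bar> + norm z + real N) * (B * 3 ^ N) * (A * p)"
      using 1 2 by (rule norm_triangle_mono)
    also have "\<dots> = norm z * C' * p"
      using z by (simp add: C'_def distrib_right mult.assoc)
    also have "\<dots> = norm z * (C' * p)"
      by (rule mult.assoc)
    finally have "norm (rGamma (z + 1) * of_real y powr (z + 1 - 1) - (\<Sum>i<M. E' i * H i)) \<le> C' * p"
      using z by simp
    then show ?thesis
      by (simp add: y_def E'_def H_def p_def)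
  qed
  with C' show "\<exists>C>0. \<exists>K. \<forall>\<tau> k. \<bar>\<tau>\<bar> \<le> T \<longrightarrow> k \<ge> K \<longrightarrow>
     norm (rGamma (z + 1) * of_real (real k + \<tau>) powr (z + 1 - 1) -
       (\<Sum>i<M. fps_nth (symbol_fps (z + 1) (- \<tau>)) i * fps_nth (binomial_series (z + 1 - of_nat i)) k))
     \<le> C * (real k + 1) powr (Re (z + 1) - 1 - real M)"
    by blast
qed

text \<open>Induction over the half-planes Re z < 1 + n. For z other than 1 the step starts at z -
  1, which is nonzero and lies in the previous half-plane.\<close>

lemma power_expansion: "power_expansion z"
proof -
  have "Re z < 1 + real n \<Longrightarrow> power_expansion z" for n
  proof (induction n arbitrary: z)
    case 0
    then show ?case by (simp add: power_expansion_base)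
  next
    case (Suc n)
    show ?case
    proof (cases "z = 1")
      case False
      have "power_expansion (z - 1)" using Suc by simp
      with False show ?thesis using power_expansion_step[of "z - 1"] by simp
    qed (simp add: power_expansion_one)
  qed
  moreover obtain n :: nat where "Re z < real n"
    using reals_Archimedean2 by blast
  then have "Re z < 1 + real n" by simp
  ultimately show ?thesis by blast
qed

subsection \<open>Convolution with the weights\<close>

lemma summable_powr_minus_2: "summable (\<lambda>k. (real k + 1) powr (- 2))"
proof -
  have "summable (\<lambda>k. real (Suc k) powr (- 2))"
    by (subst summable_Suc_iff) (simp add: summable_real_powr_iff)
  then show ?thesis by (simp add: add.commute)
qed

text \<open>Put u = j + 1 and v = N - j + 1, so that u <= N + 1 <= u v. One part v^(-|q|) of the
  decay of b converts u^q into at most (N + 1)^q for either sign of q; the other part v^(-2) makes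
  the sum converge.\<close>

lemma convolution_bound:
  fixes a b :: "nat \<Rightarrow> complex" and q :: real
  assumes AB: "A \<ge> 0" "B \<ge> 0"
    and a: "\<And>j. norm (a j) \<le> A * (real j + 1) powr q"
    and b: "\<And>k. norm (b k) \<le> B * (real k + 1) powr (- \<bar>q\<bar> - 2)"
  shows "norm (\<Sum>j\<le>N. a j * b (N - j)) \<le> A * B * (\<Sum>k. (real k + 1) powr (- 2)) * (real N + 1) powr q"
proof -
  note sm = summable_powr_minus_2
  have "norm (\<Sum>j\<le>N. a j * b (N - j)) \<le> (\<Sum>j\<le>N. A * B * (real N + 1) powr q * (real (N - j) + 1) powr (- 2))"
  proof (rule sum_norm_le)
    fix j assume "j \<in> {..N}"
    then have j: "j \<le> N" by simp
    define u where "u = real j + 1"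
    define v where "v = real (N - j) + 1"
    have uv: "u \<ge> 1" "v \<ge> 1" "u \<le> real N + 1" using j by (auto simp: u_def v_def)
    have "u * v = real N + 1 + real j * real (N - j)"
      using j by (simp add: u_def v_def algebra_simps of_nat_diff)
    then have uvN: "real N + 1 \<le> u * v" by simp
    have *: "u powr q * v powr (- \<bar>q\<bar>) \<le> (real N + 1) powr q"
    proof (cases "q \<ge> 0")
      case True
      have "u powr q * v powr (- \<bar>q\<bar>) \<le> (real N + 1) powr q * 1 powr (- \<bar>q\<bar>)"
        using uv True by (intro mult_mono powr_mono2 powr_mono2') auto
      then show ?thesis by simp
    next
      case False
      then have "u powr q * v powr (- \<bar>q\<bar>) = (u * v) powr q"
        using uv by (simp add: powr_mult)
      also have "\<dots> \<le> (real N + 1) powr q"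
        using uvN False by (intro powr_mono2') auto
      finally show ?thesis .
    qed
    have "norm (a j * b (N - j)) \<le> (A * u powr q) * (B * v powr (- \<bar>q\<bar> - 2))"
      unfolding norm_mult u_def v_def using AB by (intro mult_mono a b) auto
    also have "v powr (- \<bar>q\<bar> - 2) = v powr (- \<bar>q\<bar>) * v powr (- 2)"
      by (simp flip: powr_add)
    also have "(A * u powr q) * (B * (v powr (- \<bar>q\<bar>) * v powr (- 2))) =
        A * B * (u powr q * v powr (- \<bar>q\<bar>)) * v powr (- 2)"
      by (simp only: mult_ac)
    also have "\<dots> \<le> A * B * (real N + 1) powr q * v powr (- 2)"
      using AB * by (intro mult_right_mono mult_left_mono) auto
    finally show "norm (a j * b (N - j)) \<le> A * B * (real N + 1) powr q * (real (N - j) + 1) powr (- 2)"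
      unfolding v_def .
  qed
  also have "\<dots> = A * B * (real N + 1) powr q * (\<Sum>j\<le>N. (real (N - j) + 1) powr (- 2))"
    by (simp only: sum_distrib_left)
  also have "(\<Sum>j\<le>N. (real (N - j) + 1) powr (- 2)) = (\<Sum>k\<le>N. (real k + 1) powr (- 2))"
    by (rule sum.reindex_bij_witness[of _ "\<lambda>k. N - k" "\<lambda>k. N - k"]) auto
  also have "A * B * (real N + 1) powr q * (\<Sum>k\<le>N. (real k + 1) powr (- 2)) \<le>
      A * B * (real N + 1) powr q * (\<Sum>k. (real k + 1) powr (- 2))"
    using sm AB by (intro mult_left_mono sum_le_suminf) auto
  finally show ?thesis
    by (simp only: mult_ac)
qed

text \<open>Small \<open>k\<close> are covered because \<open>(k + \<tau>)\<^sup>z\<^sup>-\<^sup>1\<close> stays bounded as soon as \<open>\<tau>\<close> is bounded below.\<close>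
lemma power_remainder_bound:
  assumes M: "M > 0" and \<delta>: "\<delta> > 0"
  obtains C where "C > 0"
    "\<And>\<tau> k. 0 < \<tau> \<Longrightarrow> \<tau> \<le> 1 \<Longrightarrow> Re z \<ge> 1 \<or> \<delta> \<le> \<tau> \<Longrightarrow>
      norm (power_remainder z M \<tau> k) \<le> C * (real k + 1) powr (Re z - 1 - real M)"
proof -
  define s where "s = Re z - 1 - real M"
  obtain C K where C: "C > 0" and K: "\<And>\<tau> k. \<bar>\<tau>\<bar> \<le> 1 \<Longrightarrow> k \<ge> K \<Longrightarrow>
     norm (power_remainder z M \<tau> k) \<le> C * (real k + 1) powr s"
    using power_expansion[of z] M unfolding power_expansion_def s_def by blast
  obtain B where B: "B > 0"
    "\<And>\<theta> i. \<bar>\<theta>\<bar> \<le> 1 \<Longrightarrow> norm (fps_nth (symbol_fps z \<theta>) i) \<le> B * 3 ^ i"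
    by (rule symbol_fps_nth_bound[of 1 z]) (rule that)
  define S where "S = (\<lambda>k. \<Sum>i<M. B * 3 ^ i * norm (fps_nth (binomial_series (z - of_nat i)) k))"
  \<comment> \<open>A bound for all k < K: for Re z >= 1 the power is at most the one at K + 1,
    otherwise at most the one at \<delta>; the sum of both covers either case.\<close>
  define L where "L = norm (rGamma z) * ((real K + 1) powr \<bar>Re z - 1\<bar> + \<delta> powr (Re z - 1)) + (\<Sum>k<K. S k)"
  have S0: "S k \<ge> 0" for k
    unfolding S_def using B(1) by (intro sum_nonneg) simp
  have L0: "L \<ge> 0"
    unfolding L_def using S0 by (intro add_nonneg_nonneg mult_nonneg_nonneg sum_nonneg) auto
  \<comment> \<open>For k < K the product (K + 1)^|s| * (k + 1)^s is at least 1, which brings the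
    constant \<open>L\<close> into the required form.\<close>
  define C' where "C' = C + L * (real K + 1) powr \<bar>s\<bar>"
  have C': "C' > 0" "C' \<ge> C" "C' \<ge> L * (real K + 1) powr \<bar>s\<bar>"
    using C L0 by (auto simp: C'_def intro: add_pos_nonneg)
  have "norm (power_remainder z M \<tau> k) \<le> C' * (real k + 1) powr s"
    if \<tau>: "0 < \<tau>" "\<tau> \<le> 1" "Re z \<ge> 1 \<or> \<delta> \<le> \<tau>" for \<tau> k
  proof (cases "k \<ge> K")
    case True
    have "norm (power_remainder z M \<tau> k) \<le> C * (real k + 1) powr s"
      using K[of \<tau> k] True \<tau> by simp
    also have "\<dots> \<le> C' * (real k + 1) powr s"
      using C' by (intro mult_right_mono) auto
    finally show ?thesis .
  next
    case False
    have "(real k + \<tau>) powr (Re z - 1) \<le> (real K + 1) powr \<bar>Re z - 1\<bar> + \<delta> powr (Re z - 1)"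
    proof (cases "Re z \<ge> 1")
      case True
      have "(real k + \<tau>) powr (Re z - 1) \<le> (real K + 1) powr (Re z - 1)"
        using True \<tau> False by (intro powr_mono2) auto
      moreover have "\<delta> powr (Re z - 1) \<ge> 0" by simp
      ultimately show ?thesis using True by (simp add: add_increasing2)
    next
      case False
      have "(real k + \<tau>) powr (Re z - 1) \<le> \<delta> powr (Re z - 1)"
        using False \<tau> \<delta> by (intro powr_mono2') auto
      moreover have "(real K + 1) powr \<bar>Re z - 1\<bar> \<ge> 0" by simp
      ultimately show ?thesis by linarith
    qed
    then have 1: "norm (rGamma z * of_real (real k + \<tau>) powr (z - 1)) \<le>
        norm (rGamma z) * ((real K + 1) powr \<bar>Re z - 1\<bar> + \<delta> powr (Re z - 1))"
      using \<tau> norm_of_real_powr[of "real k + \<tau>" "z - 1"] unfolding norm_mult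
      by (intro mult_left_mono) auto
    have 2: "norm (\<Sum>i<M. fps_nth (symbol_fps z (- \<tau>)) i * fps_nth (binomial_series (z - of_nat i)) k) \<le> S k"
      unfolding S_def using \<tau> by (intro sum_norm_le) (auto simp: norm_mult intro!: mult_right_mono B(2))
    have "S k \<le> (\<Sum>k<K. S k)"
      using False S0 by (intro member_le_sum) auto
    with 1 2 have "norm (power_remainder z M \<tau> k) \<le> L"
      unfolding power_remainder_def L_def by (intro norm_triangle_le_diff) linarith
    also have "\<dots> = L * 1" by simp
    also have "\<dots> \<le> L * ((real K + 1) powr \<bar>s\<bar> * (real k + 1) powr s)"
    proof (rule mult_left_mono[OF _ L0])
      have "(1::real) powr s \<le> (real K + 1) powr \<bar>s\<bar> * (real k + 1) powr s"
        using False by (intro powr_le_powr_comparable) (auto simp: algebra_simps)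
      then show "1 \<le> (real K + 1) powr \<bar>s\<bar> * (real k + 1) powr s" by simp
    qed
    also have "\<dots> = (L * (real K + 1) powr \<bar>s\<bar>) * (real k + 1) powr s"
      by (simp only: mult.assoc)
    also have "\<dots> \<le> C' * (real k + 1) powr s"
      using C' by (intro mult_right_mono) auto
    finally show ?thesis .
  qed
  with C'(1) show ?thesis
    unfolding s_def by (rule that)
qed

lemma SCQ_generating_eq:
  "SCQ_generating \<alpha> \<theta> p =
     (\<Sum>l<p. fps_const (fps_nth (symbol_fps \<alpha> \<theta>) l) * binomial_series (\<alpha> - of_nat l))"
  unfolding SCQ_generating_def SCQ_gamma_def symbol_fps_def binomial_series_def [symmetric]
    binomial_series_power [symmetric] sum_distrib_left
  by (intro sum.cong refl) (simp only: mult_ac)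

text \<open>The left side is the N-th coefficient of a product of power series, in which the
  exponents of 1 - \<xi> add.\<close>

lemma SCQ_convolution_binomial_series:
  "(\<Sum>j\<le>N. fps_nth (SCQ_generating \<alpha> \<theta> p) j * fps_nth (binomial_series b) (N - j)) =
     (\<Sum>l<p. fps_nth (symbol_fps \<alpha> \<theta>) l * fps_nth (binomial_series (\<alpha> + b - of_nat l)) N)"
proof -
  have "SCQ_generating \<alpha> \<theta> p * binomial_series b =
     (\<Sum>l<p. fps_const (fps_nth (symbol_fps \<alpha> \<theta>) l) * binomial_series (\<alpha> + b - of_nat l))"
    unfolding SCQ_generating_eq sum_distrib_right
  proof (rule sum.cong[OF refl])
    fix l
    have "\<alpha> + b - of_nat l = (\<alpha> - of_nat l) + b" by simp
    then show "fps_const (fps_nth (symbol_fps \<alpha> \<theta>) l) * binomial_series (\<alpha> - of_nat l) * binomial_series b =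
        fps_const (fps_nth (symbol_fps \<alpha> \<theta>) l) * binomial_series (\<alpha> + b - of_nat l)"
      by (simp only: binomial_series_add mult.assoc)
  qed
  then have "fps_nth (SCQ_generating \<alpha> \<theta> p * binomial_series b) N =
     (\<Sum>l<p. fps_nth (symbol_fps \<alpha> \<theta>) l * fps_nth (binomial_series (\<alpha> + b - of_nat l)) N)"
    by (simp add: fps_sum_nth)
  then show ?thesis
    by (simp only: fps_mult_nth atLeast0AtMost)
qed

text \<open>As p <= M, the triangle l + i < p lies inside the rectangle. Its diagonals will form
  Cauchy product coefficients, while the rest contains only terms of order at least p.\<close>

lemma sum_triangle_split:
  fixes f :: "nat \<Rightarrow> nat \<Rightarrow> complex"
  assumes "p \<le> M"
  shows "(\<Sum>l<p. \<Sum>i<M. f l i) = (\<Sum>m<p. \<Sum>l\<le>m. f l (m - l)) + (\<Sum>l<p. \<Sum>i<M. if l + i < p then 0 else f l i)"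
proof -
  have "(\<Sum>l<p. \<Sum>i<M. if l + i < p then f l i else 0) =
        (\<Sum>(l, i)\<in>{..<p} \<times> {..<M}. if l + i < p then f l i else 0)"
    by (simp add: sum.cartesian_product)
  also have "\<dots> = (\<Sum>(l, i)\<in>{(l, i). l + i < p}. f l i)"
    by (rule sum.mono_neutral_cong_right) (use assms in \<open>auto split: if_splits\<close>)
  also have "\<dots> = (\<Sum>m<p. \<Sum>l\<le>m. f l (m - l))"
    by (rule sum.triangle_reindex)
  finally have "(\<Sum>m<p. \<Sum>l\<le>m. f l (m - l)) + (\<Sum>l<p. \<Sum>i<M. if l + i < p then 0 else f l i) =
     (\<Sum>l<p. \<Sum>i<M. (if l + i < p then f l i else 0) + (if l + i < p then 0 else f l i))"
    by (simp only: sum.distrib)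
  also have "\<dots> = (\<Sum>l<p. \<Sum>i<M. f l i)"
    by (intro sum.cong refl) auto
  finally show ?thesis by simp
qed

text \<open>The l-th summand of the generating function is bounded by a multiple of j^(Re \<alpha> -
  1 - l), so the estimate for l = 0 dominates.\<close>

lemma SCQ_generating_nth_bound:
  obtains A where "A > 0"
    "\<And>j. norm (fps_nth (SCQ_generating \<alpha> \<theta> p) j) \<le> A * (real j + 1) powr (Re \<alpha> - 1)"
proof -
  have "\<exists>C. \<forall>l. C l > 0 \<and> (\<forall>k. norm (fps_nth (binomial_series (\<alpha> - of_nat l)) k) \<le> C l * (real k + 1) powr (Re (\<alpha> - of_nat l) - 1))"
    by (intro choice allI) (metis binomial_series_nth_bound)
  then obtain C where C: "\<And>l. C l > 0"
    "\<And>l k. norm (fps_nth (binomial_series (\<alpha> - of_nat l)) k) \<le> C l * (real k + 1) powr (Re (\<alpha> - of_nat l) - 1)"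
    by blast
  define A where "A = 1 + (\<Sum>l<p. norm (fps_nth (symbol_fps \<alpha> \<theta>) l) * C l)"
  have A: "A > 0"
    unfolding A_def using C(1) by (intro add_pos_nonneg sum_nonneg) (auto simp: less_imp_le)
  have "norm (fps_nth (SCQ_generating \<alpha> \<theta> p) j) \<le> A * (real j + 1) powr (Re \<alpha> - 1)" for j
  proof -
    have "norm (fps_nth (SCQ_generating \<alpha> \<theta> p) j) \<le>
       (\<Sum>l<p. norm (fps_nth (symbol_fps \<alpha> \<theta>) l) * C l * (real j + 1) powr (Re \<alpha> - 1))"
      unfolding SCQ_generating_eq fps_sum_nth fps_mult_left_const_nth
    proof (rule sum_norm_le)
      fix l
      have "norm (fps_nth (binomial_series (\<alpha> - of_nat l)) j) \<le> C l * (real j + 1) powr (Re (\<alpha> - of_nat l) - 1)"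
        by (rule C)
      also have "\<dots> \<le> C l * (real j + 1) powr (Re \<alpha> - 1)"
        using C(1)[of l] by (intro mult_left_mono powr_mono) auto
      finally have "norm (fps_nth (symbol_fps \<alpha> \<theta>) l) * norm (fps_nth (binomial_series (\<alpha> - of_nat l)) j) \<le>
          norm (fps_nth (symbol_fps \<alpha> \<theta>) l) * (C l * (real j + 1) powr (Re \<alpha> - 1))"
        by (rule mult_left_mono) simp
      then show "norm (fps_nth (symbol_fps \<alpha> \<theta>) l * fps_nth (binomial_series (\<alpha> - of_nat l)) j) \<le>
          norm (fps_nth (symbol_fps \<alpha> \<theta>) l) * C l * (real j + 1) powr (Re \<alpha> - 1)"
        by (simp add: norm_mult mult.assoc)
    qed
    also have "\<dots> \<le> A * (real j + 1) powr (Re \<alpha> - 1)"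
      unfolding sum_distrib_right [symmetric] A_def by (intro mult_right_mono) auto
    finally show ?thesis .
  qed
  with A show ?thesis by (rule that)
qed

lemma SCQ_sum_asymptotics:
  fixes \<alpha> \<beta> :: complex
  assumes \<beta>: "\<beta> \<notin> \<int>\<^sub>\<le>\<^sub>0" and p: "p > 0" and \<delta>: "\<delta> > 0"
  obtains C K where "C > 0"
    "\<And>\<tau> N. N \<ge> K \<Longrightarrow> 0 < \<tau> \<Longrightarrow> \<tau> \<le> 1 \<Longrightarrow> Re \<beta> \<ge> 1 \<or> \<delta> \<le> \<tau> \<Longrightarrow>
      norm ((\<Sum>j\<le>N. fps_nth (SCQ_generating \<alpha> \<theta> p) j * of_real (real (N - j) + \<tau>) powr (\<beta> - 1)) -
        Gamma \<beta> * rGamma (\<alpha> + \<beta>) * of_real (real N + \<tau> - \<theta>) powr (\<alpha> + \<beta> - 1))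
      \<le> C * ((real N + 1) powr (Re (\<alpha> + \<beta>) - 1 - real p) + (real N + 1) powr (Re \<alpha> - 1))"
proof -
  define q where "q = Re \<alpha> - 1"
  define s where "s = Re (\<alpha> + \<beta>) - 1 - real p"
  define W where "W = (\<Sum>k. (real k + 1) powr (- 2))"
  define \<omega> where "\<omega> = fps_nth (SCQ_generating \<alpha> \<theta> p)"
  \<comment> \<open>The expansion of the sampled power is carried n terms beyond p, so that its
    remainder has the decay of order |q| + 2 required by \<open>convolution_bound\<close>.\<close>
  obtain n :: nat where n: "real n \<ge> Re \<beta> - 1 + \<bar>q\<bar> + 2"
    using real_arch_simple by blast
  define M where "M = p + n"
  have M: "M > 0" "p \<le> M" "Re \<beta> - 1 - real M \<le> - \<bar>q\<bar> - 2"
    using p n by (auto simp: M_def)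
  obtain C1 where C1: "C1 > 0" "\<And>\<tau> k. 0 < \<tau> \<Longrightarrow> \<tau> \<le> 1 \<Longrightarrow> Re \<beta> \<ge> 1 \<or> \<delta> \<le> \<tau> \<Longrightarrow>
      norm (power_remainder \<beta> M \<tau> k) \<le> C1 * (real k + 1) powr (Re \<beta> - 1 - real M)"
    by (rule power_remainder_bound[OF M(1) \<delta>, of \<beta>]) (rule that)
  obtain A where A: "A > 0" "\<And>j. norm (\<omega> j) \<le> A * (real j + 1) powr q"
    by (rule SCQ_generating_nth_bound[of \<alpha> \<theta> p]) (rule that, unfold \<omega>_def q_def)
  obtain B where B: "B > 0"
    "\<And>\<theta> i. \<bar>\<theta>\<bar> \<le> 1 \<Longrightarrow> norm (fps_nth (symbol_fps \<beta> \<theta>) i) \<le> B * 3 ^ i"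
    by (rule symbol_fps_nth_bound[of 1 \<beta>]) (rule that)
  \<comment> \<open>For the exact value p terms suffice. The range 1 + |\<theta>| is needed because
    the shift there is \<tau> - \<theta>.\<close>
  obtain C2 K where C2: "C2 > 0" and K: "\<And>\<tau> k. \<bar>\<tau>\<bar> \<le> 1 + \<bar>\<theta>\<bar> \<Longrightarrow> k \<ge> K \<Longrightarrow>
     norm (power_remainder (\<alpha> + \<beta>) p \<tau> k) \<le> C2 * (real k + 1) powr s"
    using power_expansion[of "\<alpha> + \<beta>"] p unfolding power_expansion_def s_def by blast
  have "\<exists>D. \<forall>m. D m > 0 \<and> (\<forall>k. norm (fps_nth (binomial_series (\<alpha> + \<beta> - of_nat m)) k) \<le>
      D m * (real k + 1) powr (Re (\<alpha> + \<beta> - of_nat m) - 1))"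
    by (intro choice allI) (metis binomial_series_nth_bound)
  then obtain D where D: "\<And>m. D m > 0"
    "\<And>m k. norm (fps_nth (binomial_series (\<alpha> + \<beta> - of_nat m)) k) \<le>
      D m * (real k + 1) powr (Re (\<alpha> + \<beta> - of_nat m) - 1)"
    by blast
  define \<gamma> where "\<gamma> = fps_nth (symbol_fps \<alpha> \<theta>)"
  define C3 where "C3 = (\<Sum>l<p. \<Sum>i<M. norm (\<gamma> l) * (B * 3 ^ i) * D (l + i))"
  have C3: "C3 \<ge> 0"
    unfolding C3_def using B(1) D(1) by (intro sum_nonneg mult_nonneg_nonneg) (auto simp: less_imp_le)
  define C where "C = norm (Gamma \<beta>) * (C3 + C2 + A * C1 * W) + 1"
  have W: "W \<ge> 0"
    unfolding W_def by (rule suminf_nonneg[OF summable_powr_minus_2]) simp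
  have C: "C > 0"
    unfolding C_def using C3 C2 A(1) C1(1) W by (intro add_nonneg_pos mult_nonneg_nonneg) auto
  have "norm ((\<Sum>j\<le>N. \<omega> j * of_real (real (N - j) + \<tau>) powr (\<beta> - 1)) -
        Gamma \<beta> * rGamma (\<alpha> + \<beta>) * of_real (real N + \<tau> - \<theta>) powr (\<alpha> + \<beta> - 1))
      \<le> C * ((real N + 1) powr s + (real N + 1) powr q)"
    if N: "N \<ge> K" and \<tau>: "0 < \<tau>" "\<tau> \<le> 1" "Re \<beta> \<ge> 1 \<or> \<delta> \<le> \<tau>" for \<tau> N
  proof -
    define E where "E = fps_nth (symbol_fps \<beta> (- \<tau>))"
    define c where "c = (\<lambda>m. fps_nth (binomial_series (\<alpha> + \<beta> - of_nat m)) N)"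
    define r where "r = power_remainder \<beta> M \<tau>"
    have "Gamma \<beta> * rGamma \<beta> = 1"
      using \<beta> by (simp add: Gamma_def rGamma_eq_zero_iff)
    then have g: "of_real (real k + \<tau>) powr (\<beta> - 1) =
       Gamma \<beta> * ((\<Sum>i<M. E i * fps_nth (binomial_series (\<beta> - of_nat i)) k) + r k)" for k
      by (simp add: r_def power_remainder_def E_def flip: mult.assoc)
    have "(\<Sum>j\<le>N. \<omega> j * of_real (real (N - j) + \<tau>) powr (\<beta> - 1)) =
       Gamma \<beta> * ((\<Sum>j\<le>N. \<Sum>i<M. E i * (\<omega> j * fps_nth (binomial_series (\<beta> - of_nat i)) (N - j)))
         + (\<Sum>j\<le>N. \<omega> j * r (N - j)))"
      unfolding g distrib_left sum.distrib sum_distrib_left by (simp only: mult_ac)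
    also have "(\<Sum>j\<le>N. \<Sum>i<M. E i * (\<omega> j * fps_nth (binomial_series (\<beta> - of_nat i)) (N - j))) =
       (\<Sum>i<M. E i * (\<Sum>j\<le>N. \<omega> j * fps_nth (binomial_series (\<beta> - of_nat i)) (N - j)))"
      unfolding sum_distrib_left by (rule sum.swap)
    also have "\<dots> = (\<Sum>i<M. \<Sum>l<p. \<gamma> l * E i * c (l + i))"
    proof (rule sum.cong[OF refl])
      fix i
      have "\<alpha> + (\<beta> - of_nat i) - of_nat l = \<alpha> + \<beta> - of_nat (l + i)" for l
        by simp
      then show "E i * (\<Sum>j\<le>N. \<omega> j * fps_nth (binomial_series (\<beta> - of_nat i)) (N - j)) =
          (\<Sum>l<p. \<gamma> l * E i * c (l + i))"
        unfolding \<omega>_def SCQ_convolution_binomial_series sum_distrib_left c_def \<gamma>_def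
        by (simp only: mult_ac)
    qed
    also have "\<dots> = (\<Sum>l<p. \<Sum>i<M. \<gamma> l * E i * c (l + i))"
      by (rule sum.swap)
    also have "\<dots> = (\<Sum>m<p. \<Sum>l\<le>m. \<gamma> l * E (m - l) * c (l + (m - l))) +
        (\<Sum>l<p. \<Sum>i<M. if l + i < p then 0 else \<gamma> l * E i * c (l + i))"
      by (rule sum_triangle_split[OF M(2)])
    \<comment> \<open>The diagonals are the coefficients of the product of the two symbols, that is,
      of the symbol for \<alpha> + \<beta> with shift \<theta> - \<tau>: the quadrature reproduces
      the first p terms of the exact value.\<close>
    also have "(\<Sum>m<p. \<Sum>l\<le>m. \<gamma> l * E (m - l) * c (l + (m - l))) =
        (\<Sum>m<p. fps_nth (symbol_fps (\<alpha> + \<beta>) (- (\<tau> - \<theta>))) m * c m)"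
    proof (rule sum.cong[OF refl])
      fix m
      have "symbol_fps (\<alpha> + \<beta>) (- (\<tau> - \<theta>)) = symbol_fps \<alpha> \<theta> * symbol_fps \<beta> (- \<tau>)"
        by (simp add: symbol_fps_mult)
      then show "(\<Sum>l\<le>m. \<gamma> l * E (m - l) * c (l + (m - l))) =
          fps_nth (symbol_fps (\<alpha> + \<beta>) (- (\<tau> - \<theta>))) m * c m"
        by (simp add: fps_mult_nth atLeast0AtMost sum_distrib_right \<gamma>_def E_def)
    qed
    also have "\<dots> = rGamma (\<alpha> + \<beta>) * of_real (real N + \<tau> - \<theta>) powr (\<alpha> + \<beta> - 1) -
        power_remainder (\<alpha> + \<beta>) p (\<tau> - \<theta>) N"
      by (simp add: power_remainder_def c_def add_diff_eq)
    finally have eq: "(\<Sum>j\<le>N. \<omega> j * of_real (real (N - j) + \<tau>) powr (\<beta> - 1)) -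
        Gamma \<beta> * rGamma (\<alpha> + \<beta>) * of_real (real N + \<tau> - \<theta>) powr (\<alpha> + \<beta> - 1) =
        Gamma \<beta> * ((\<Sum>l<p. \<Sum>i<M. if l + i < p then 0 else \<gamma> l * E i * c (l + i))
          - power_remainder (\<alpha> + \<beta>) p (\<tau> - \<theta>) N + (\<Sum>j\<le>N. \<omega> j * r (N - j)))"
      by (simp add: algebra_simps)
    have 1: "norm (\<Sum>l<p. \<Sum>i<M. if l + i < p then 0 else \<gamma> l * E i * c (l + i)) \<le> C3 * (real N + 1) powr s"
      unfolding C3_def sum_distrib_right
    proof (intro sum_norm_le)
      fix l i
      have nn: "0 \<le> norm (\<gamma> l) * (B * 3 ^ i) * D (l + i) * (real N + 1) powr s"
        using B(1) D(1)[of "l + i"] by simp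
      have "norm (\<gamma> l * E i * c (l + i)) \<le> norm (\<gamma> l) * (B * 3 ^ i) * D (l + i) * (real N + 1) powr s"
        if "\<not> l + i < p"
      proof -
        have "norm (c (l + i)) \<le> D (l + i) * (real N + 1) powr (Re (\<alpha> + \<beta> - of_nat (l + i)) - 1)"
          unfolding c_def by (rule D)
        also have "\<dots> \<le> D (l + i) * (real N + 1) powr s"
          using D(1)[of "l + i"] that by (intro mult_left_mono powr_mono) (auto simp: s_def)
        finally have "norm (c (l + i)) \<le> D (l + i) * (real N + 1) powr s" .
        moreover have "norm (E i) \<le> B * 3 ^ i"
          unfolding E_def using \<tau> by (intro B(2)) simp
        ultimately have "norm (\<gamma> l) * norm (E i) * norm (c (l + i)) \<le>
            norm (\<gamma> l) * (B * 3 ^ i) * (D (l + i) * (real N + 1) powr s)"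
          using B(1) by (intro mult_mono) auto
        then show ?thesis by (simp only: norm_mult mult.assoc)
      qed
      with nn show "norm (if l + i < p then 0 else \<gamma> l * E i * c (l + i)) \<le>
          norm (\<gamma> l) * (B * 3 ^ i) * D (l + i) * (real N + 1) powr s"
        by simp
    qed
    have 2: "norm (power_remainder (\<alpha> + \<beta>) p (\<tau> - \<theta>) N) \<le> C2 * (real N + 1) powr s"
      using \<tau> by (intro K N) auto
    have 3: "norm (\<Sum>j\<le>N. \<omega> j * r (N - j)) \<le> A * C1 * W * (real N + 1) powr q"
      unfolding W_def
    proof (rule convolution_bound)
      fix k
      have "norm (r k) \<le> C1 * (real k + 1) powr (Re \<beta> - 1 - real M)"
        unfolding r_def by (rule C1(2)[OF \<tau>])
      also have "\<dots> \<le> C1 * (real k + 1) powr (- \<bar>q\<bar> - 2)"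
        using C1(1) M(3) by (intro mult_left_mono powr_mono) auto
      finally show "norm (r k) \<le> C1 * (real k + 1) powr (- \<bar>q\<bar> - 2)" .
    qed (use A C1(1) in \<open>auto simp: less_imp_le\<close>)
    define a where "a = (real N + 1) powr s"
    define b where "b = (real N + 1) powr q"
    have ab: "a \<ge> 0" "b \<ge> 0" by (simp_all add: a_def b_def)
    have "norm ((\<Sum>l<p. \<Sum>i<M. if l + i < p then 0 else \<gamma> l * E i * c (l + i))
          - power_remainder (\<alpha> + \<beta>) p (\<tau> - \<theta>) N + (\<Sum>j\<le>N. \<omega> j * r (N - j))) \<le>
        (C3 * a + C2 * a) + A * C1 * W * b"
      using 1 2 3 unfolding a_def b_def
      by (intro order_trans[OF norm_triangle_ineq] add_mono order_trans[OF norm_triangle_ineq4]) auto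
    also have "\<dots> \<le> (C3 + C2 + A * C1 * W) * (a + b)"
      using ab C3 C2 A(1) C1(1) W by (simp add: algebra_simps)
    finally have "norm (Gamma \<beta>) * norm ((\<Sum>l<p. \<Sum>i<M. if l + i < p then 0 else \<gamma> l * E i * c (l + i))
          - power_remainder (\<alpha> + \<beta>) p (\<tau> - \<theta>) N + (\<Sum>j\<le>N. \<omega> j * r (N - j))) \<le>
        norm (Gamma \<beta>) * ((C3 + C2 + A * C1 * W) * (a + b))"
      by (rule mult_left_mono) simp
    also have "\<dots> = (norm (Gamma \<beta>) * (C3 + C2 + A * C1 * W)) * (a + b)"
      by (simp only: mult.assoc)
    also have "\<dots> \<le> C * (a + b)"
      using ab by (intro mult_right_mono) (auto simp: C_def)
    finally show ?thesis
      unfolding eq norm_mult a_def b_def .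
  qed
  with C show ?thesis
    unfolding \<omega>_def s_def q_def by (rule that)
qed

subsection \<open>The quadrature error\<close>

text \<open>With \<tau> in (0, 1] the nodes h * (N - j + \<tau>) for j <= N are positive. If \<tau>
  = 1 there is one more node, j = N + 1, at t = 0; there \<open>pow_fun \<beta>\<close> vanishes
  unless \<beta> = 1, which explains the last summand.\<close>

lemma SCQ_pow_fun_eq:
  assumes h: "h > 0" and y: "1 / h + \<theta> = real N + \<tau>" and \<tau>: "0 < \<tau>" "\<tau> \<le> 1"
  shows "SCQ \<omega> \<alpha> \<theta> h (pow_fun \<beta>) 1 =
    of_real h powr (\<alpha> + \<beta> - 1) * (\<Sum>j\<le>N. \<omega> j * of_real (real (N - j) + \<tau>) powr (\<beta> - 1)) +
    of_real h powr \<alpha> * (if \<tau> = 1 \<and> \<beta> = 1 then \<omega> (Suc N) else 0)"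
proof -
  have hy: "1 + \<theta> * h = h * (real N + \<tau>)"
    unfolding y [symmetric] using h by (simp add: field_simps)
  then have node: "1 + (\<theta> - real j) * h = h * (real N + \<tau> - real j)" for j
    by (simp add: algebra_simps)
  have le: "real j * h \<le> 1 + \<theta> * h \<longleftrightarrow> real j \<le> real N + \<tau>" for j
    unfolding hy using h by (simp add: mult.commute)
  have "{j. 0 \<le> real j * h \<and> real j * h \<le> 1 + \<theta> * h} = {..N} \<union> (if \<tau> = 1 then {Suc N} else {})"
    unfolding le using \<tau> h by auto
  then have "(\<Sum>j | 0 \<le> real j * h \<and> real j * h \<le> 1 + \<theta> * h. \<omega> j * pow_fun \<beta> (1 + (\<theta> - real j) * h)) =
     (\<Sum>j\<le>N. \<omega> j * pow_fun \<beta> (h * (real N + \<tau> - real j))) +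
       (if \<tau> = 1 then \<omega> (Suc N) * pow_fun \<beta> 0 else 0)"
    unfolding node by (simp add: add.commute)
  also have "(\<Sum>j\<le>N. \<omega> j * pow_fun \<beta> (h * (real N + \<tau> - real j))) =
      of_real h powr (\<beta> - 1) * (\<Sum>j\<le>N. \<omega> j * of_real (real (N - j) + \<tau>) powr (\<beta> - 1))"
    unfolding sum_distrib_left
  proof (rule sum.cong[OF refl])
    fix j assume "j \<in> {..N}"
    then have *: "real N + \<tau> - real j = real (N - j) + \<tau>" by (simp add: of_nat_diff)
    have pos: "real (N - j) + \<tau> > 0" using \<tau> by simp
    then have "h * (real (N - j) + \<tau>) \<noteq> 0" using h by simp
    then have "pow_fun \<beta> (h * (real (N - j) + \<tau>)) = complex_of_real (h * (real (N - j) + \<tau>)) powr (\<beta> - 1)"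
      unfolding pow_fun_def by (simp del: of_real_mult of_real_add)
    also have "\<dots> = of_real h powr (\<beta> - 1) * of_real (real (N - j) + \<tau>) powr (\<beta> - 1)"
      by (rule powr_of_real_mult[OF h pos])
    finally show "\<omega> j * pow_fun \<beta> (h * (real N + \<tau> - real j)) =
        of_real h powr (\<beta> - 1) * (\<omega> j * of_real (real (N - j) + \<tau>) powr (\<beta> - 1))"
      unfolding * by simp
  qed
  finally have "SCQ \<omega> \<alpha> \<theta> h (pow_fun \<beta>) 1 = of_real h powr \<alpha> *
      (of_real h powr (\<beta> - 1) * (\<Sum>j\<le>N. \<omega> j * of_real (real (N - j) + \<tau>) powr (\<beta> - 1)) +
       (if \<tau> = 1 then \<omega> (Suc N) * pow_fun \<beta> 0 else 0))"
    unfolding SCQ_def by simp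
  also have "(if \<tau> = 1 then \<omega> (Suc N) * pow_fun \<beta> 0 else 0) = (if \<tau> = 1 \<and> \<beta> = 1 then \<omega> (Suc N) else 0)"
    by (simp add: pow_fun_def)
  finally show ?thesis
    by (simp add: distrib_left add_diff_eq flip: powr_add mult.assoc)
qed

lemma powr_scaled_le:
  fixes h q m :: real
  assumes "h > 0" "m > 0" "m \<le> c * (1 / h)" "1 / h \<le> c * m"
  shows "m powr q \<le> c powr \<bar>q\<bar> * h powr (- q)"
proof -
  have "m powr q \<le> c powr \<bar>q\<bar> * (1 / h) powr q"
    using assms by (intro powr_le_powr_comparable) auto
  also have "(1 / h) powr q = h powr (- q)"
    using assms(1) by (subst powr_divide) (simp_all add: powr_minus divide_inverse)
  finally show ?thesis .
qed

lemma SCQ_error_bound: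
  assumes \<beta>: "\<beta> \<notin> \<int>\<^sub>\<le>\<^sub>0" and p: "p > 0" and \<delta>: "\<delta> > 0"
  obtains C h0 where "C > 0" "h0 > 0"
    "\<And>h. h \<in> SCQ_steps \<theta> \<beta> \<delta> \<Longrightarrow> h < h0 \<Longrightarrow>
      norm (SCQ_error_power (fps_nth (SCQ_generating \<alpha> \<theta> p)) \<alpha> \<theta> h \<beta> 1) \<le> C * (h powr Re \<beta> + h ^ p)"
proof -
  define \<omega> where "\<omega> = fps_nth (SCQ_generating \<alpha> \<theta> p)"
  define s where "s = Re (\<alpha> + \<beta>) - 1 - real p"
  define q where "q = Re \<alpha> - 1"
  obtain C1 K where C1: "C1 > 0" and K:
    "\<And>\<tau> N. N \<ge> K \<Longrightarrow> 0 < \<tau> \<Longrightarrow> \<tau> \<le> 1 \<Longrightarrow> Re \<beta> \<ge> 1 \<or> \<delta> \<le> \<tau> \<Longrightarrow>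
      norm ((\<Sum>j\<le>N. \<omega> j * of_real (real (N - j) + \<tau>) powr (\<beta> - 1)) -
        Gamma \<beta> * rGamma (\<alpha> + \<beta>) * of_real (real N + \<tau> - \<theta>) powr (\<alpha> + \<beta> - 1))
      \<le> C1 * ((real N + 1) powr s + (real N + 1) powr q)"
    by (rule SCQ_sum_asymptotics[OF \<beta> p \<delta>, of \<alpha> \<theta>]) (rule that, unfold \<omega>_def s_def q_def)
  obtain A where A: "A > 0" "\<And>j. norm (\<omega> j) \<le> A * (real j + 1) powr q"
    by (rule SCQ_generating_nth_bound[of \<alpha> \<theta> p]) (rule that, unfold \<omega>_def q_def)
  define C2 where "C2 = max (2 powr \<bar>s\<bar>) (2 powr \<bar>q\<bar>)"
  have C2: "C2 > 0" "2 powr \<bar>s\<bar> \<le> C2" "2 powr \<bar>q\<bar> \<le> C2"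
    by (auto simp: C2_def less_max_iff_disj)
  define C where "C = C1 * C2 + A * 3 powr \<bar>q\<bar>"
  have C: "C > 0" unfolding C_def using C1 C2 A(1) by (intro add_pos_pos mult_pos_pos) auto
  \<comment> \<open>For 1/h > X, the number 1/h + \<theta> exceeds K + 1, so N >= K, and N + 1
    agrees with 1/h up to a factor 2.\<close>
  define X where "X = 2 * \<bar>\<theta>\<bar> + 2 * real K + 4"
  have X: "X > 0" by (simp add: X_def add_nonneg_pos)
  have "norm (SCQ_error_power \<omega> \<alpha> \<theta> h \<beta> 1) \<le> C * (h powr Re \<beta> + h ^ p)"
    if hs: "h \<in> SCQ_steps \<theta> \<beta> \<delta>" and hX: "h < 1 / X" for h
  proof -
    have h: "h > 0" using hs by (simp add: SCQ_steps_def)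
    have "1 / h > X" using h hX X by (simp add: field_simps)
    define u where "u = 1 / h"
    define t where "t = \<bar>\<theta>\<bar>"
    have x: "u > 2 * t + 2 * real K + 4" "\<theta> \<le> t" "- \<theta> \<le> t" "real K \<ge> 0"
      using \<open>1 / h > X\<close> by (simp_all add: X_def u_def t_def)
    define y where "y = 1 / h + \<theta>"
    have y1: "y > real K + 1" using x unfolding y_def u_def [symmetric] by linarith
    \<comment> \<open>Ceiling minus one instead of the floor: this puts \<tau> into (0, 1], so that
      N + \<tau> - j stays positive for all j <= N.\<close>
    define N where "N = nat (\<lceil>y\<rceil> - 1)"
    define \<tau> where "\<tau> = y - real N"
    have rN: "real N = of_int \<lceil>y\<rceil> - 1"
      using y1 by (simp add: N_def)
    have \<tau>: "0 < \<tau>" "\<tau> \<le> 1"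
      unfolding \<tau>_def rN by linarith+
    have yN: "1 / h + \<theta> = real N + \<tau>" by (simp add: \<tau>_def y_def)
    have NK: "N \<ge> K" using y1 \<tau> by (simp add: \<tau>_def)
    \<comment> \<open>The node with index N lies at \<tau> h, and the admissible step sizes exclude
      nodes strictly between 0 and \<delta> h when Re \<beta> < 1.\<close>
    have \<tau>\<delta>: "Re \<beta> \<ge> 1 \<or> \<delta> \<le> \<tau>"
    proof (rule ccontr)
      assume "\<not> ?thesis"
      then have *: "\<not> Re \<beta> \<ge> 1" "\<tau> < \<delta>" by auto
      have "1 + (\<theta> - real N) * h = \<tau> * h"
        using h yN by (simp add: field_simps)
      then have "0 < 1 + (\<theta> - real N) * h \<and> 1 + (\<theta> - real N) * h < \<delta> * h"
        using \<tau> * h by simp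
      with hs *(1) show False by (auto simp: SCQ_steps_def)
    qed
    define S where "S = (\<Sum>j\<le>N. \<omega> j * of_real (real (N - j) + \<tau>) powr (\<beta> - 1))"
    define G where "G = Gamma \<beta> * rGamma (\<alpha> + \<beta>)"
    define V where "V = (if \<tau> = 1 \<and> \<beta> = 1 then \<omega> (Suc N) else 0)"
    have Nx: "real N + \<tau> - \<theta> = 1 / h" using yN by simp
    have "of_real h powr (\<alpha> + \<beta> - 1) * of_real (1 / h) powr (\<alpha> + \<beta> - 1) = complex_of_real (h * (1 / h)) powr (\<alpha> + \<beta> - 1)"
      using h by (intro powr_of_real_mult [symmetric]) auto
    then have hx: "of_real h powr (\<alpha> + \<beta> - 1) * of_real (1 / h) powr (\<alpha> + \<beta> - 1) = (1 :: complex)"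
      using h by simp
    have "SCQ_error_power \<omega> \<alpha> \<theta> h \<beta> 1 = of_real h powr (\<alpha> + \<beta> - 1) * S + of_real h powr \<alpha> * V - G * 1"
      unfolding SCQ_error_power_def SCQ_pow_fun_eq[OF h yN \<tau>] RL_power_eq[OF zero_less_one] S_def V_def G_def
      by simp
    also have "\<dots> = of_real h powr (\<alpha> + \<beta> - 1) * (S - G * of_real (1 / h) powr (\<alpha> + \<beta> - 1)) + of_real h powr \<alpha> * V"
    proof -
      have "G * 1 = of_real h powr (\<alpha> + \<beta> - 1) * (G * of_real (1 / h) powr (\<alpha> + \<beta> - 1))"
        by (simp only: mult.left_commute [of _ G] hx)
      moreover have "a * S + v - a * g = a * (S - g) + v" for a v g
        by (simp add: algebra_simps)
      ultimately show ?thesis by (simp only:)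
    qed
    finally have "norm (SCQ_error_power \<omega> \<alpha> \<theta> h \<beta> 1) \<le>
        h powr (Re (\<alpha> + \<beta>) - 1) * norm (S - G * of_real (1 / h) powr (\<alpha> + \<beta> - 1)) + h powr Re \<alpha> * norm V"
      using norm_triangle_ineq[of "of_real h powr (\<alpha> + \<beta> - 1) * (S - G * of_real (1 / h) powr (\<alpha> + \<beta> - 1))" "of_real h powr \<alpha> * V"] h
      by (simp add: norm_mult norm_of_real_powr)
    also have "norm (S - G * of_real (1 / h) powr (\<alpha> + \<beta> - 1)) \<le> C1 * ((real N + 1) powr s + (real N + 1) powr q)"
      using K[OF NK \<tau> \<tau>\<delta>] unfolding S_def G_def Nx .
    also have "C1 * ((real N + 1) powr s + (real N + 1) powr q) \<le> C1 * (C2 * h powr (- s) + C2 * h powr (- q))"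
    proof (intro mult_left_mono add_mono)
      have 1: "real N + 1 \<le> 2 * (1 / h)" "1 / h \<le> 2 * (real N + 1)"
        using x yN \<tau> unfolding u_def [symmetric] distrib_left by linarith+
      show "(real N + 1) powr s \<le> C2 * h powr (- s)"
        by (rule order_trans[OF powr_scaled_le[OF h _ 1] mult_right_mono[OF C2(2)]]) auto
      show "(real N + 1) powr q \<le> C2 * h powr (- q)"
        by (rule order_trans[OF powr_scaled_le[OF h _ 1] mult_right_mono[OF C2(3)]]) auto
    qed (use C1 in simp)
    \<comment> \<open>The exponents s and q are such that the scaling factor turns h^(-s) into h^p
      and h^(-q) into h^(Re \<beta>).\<close>
    also have "h powr (Re (\<alpha> + \<beta>) - 1) * (C1 * (C2 * h powr (- s) + C2 * h powr (- q))) =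
        C1 * C2 * (h powr (Re (\<alpha> + \<beta>) - 1 + - s) + h powr (Re (\<alpha> + \<beta>) - 1 + - q))"
      unfolding powr_add by (simp only: distrib_left mult_ac)
    also have "h powr (Re (\<alpha> + \<beta>) - 1 + - s) = h ^ p"
      using h by (simp add: s_def powr_realpow)
    also have "Re (\<alpha> + \<beta>) - 1 + - q = Re \<beta>"
      by (simp add: q_def)
    also have "h powr Re \<alpha> * norm V \<le> A * 3 powr \<bar>q\<bar> * h powr Re \<beta>"
    \<comment> \<open>The extra node counts only for \<beta> = 1, where Re \<alpha> - q = 1 = Re
      \<beta>, so its contribution is of order h^(Re \<beta>).\<close>
    proof (cases "\<tau> = 1 \<and> \<beta> = 1")
      case True
      have 1: "real (Suc N) + 1 \<le> 3 * (1 / h)" "1 / h \<le> 3 * (real (Suc N) + 1)"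
        using x yN \<tau> unfolding u_def [symmetric] of_nat_Suc distrib_left by linarith+
      have "norm V \<le> A * (real (Suc N) + 1) powr q"
        using True A(2)[of "Suc N"] by (simp add: V_def)
      also have "\<dots> \<le> A * (3 powr \<bar>q\<bar> * h powr (- q))"
        using A(1) by (intro mult_left_mono powr_scaled_le[OF h _ 1]) auto
      finally have "h powr Re \<alpha> * norm V \<le> h powr Re \<alpha> * (A * (3 powr \<bar>q\<bar> * h powr (- q)))"
        by (rule mult_left_mono) simp
      also have "\<dots> = A * 3 powr \<bar>q\<bar> * h powr (Re \<alpha> + - q)"
        unfolding powr_add by (simp only: mult_ac)
      also have "Re \<alpha> + - q = Re \<beta>"
        using True by (simp add: q_def)
      finally show ?thesis .
    qed (use A(1) in \<open>auto simp: V_def\<close>)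
    finally have "norm (SCQ_error_power \<omega> \<alpha> \<theta> h \<beta> 1) \<le>
        C1 * C2 * (h ^ p + h powr Re \<beta>) + A * 3 powr \<bar>q\<bar> * h powr Re \<beta>"
      using h by (simp add: mult_left_mono)
    also have "\<dots> \<le> C * (h powr Re \<beta> + h ^ p)"
      using A(1) h by (simp add: C_def algebra_simps)
    finally show ?thesis .
  qed
  moreover have "1 / X > 0" using X by simp
  ultimately show ?thesis
    using C unfolding \<omega>_def by (intro that[of C "1 / X"])
qed

theorem corollary2p14:
  fixes \<alpha> :: complex and \<theta> :: real and p :: nat
  assumes "p > 0"
  shows "SCQ_convergent_of_order (fps_nth (SCQ_generating \<alpha> \<theta> p)) \<alpha> \<theta> p"
  unfolding SCQ_convergent_of_order_def Let_def
proof (intro allI impI)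
  fix \<beta> :: complex and \<delta> :: real
  assume \<beta>: "\<beta> \<notin> \<int>\<^sub>\<le>\<^sub>0" and \<delta>: "\<delta> > 0"
  define S where "S = SCQ_steps \<theta> \<beta> \<delta>"
  define err where "err = (\<lambda>h. SCQ_error_power (fps_nth (SCQ_generating \<alpha> \<theta> p)) \<alpha> \<theta> h \<beta> 1)"
  obtain C h0 where C: "C > 0" and h0: "h0 > 0" and
    bound: "\<And>h. h \<in> S \<Longrightarrow> h < h0 \<Longrightarrow> norm (err h) \<le> C * (h powr Re \<beta> + h ^ p)"
    by (rule SCQ_error_bound[OF \<beta> assms \<delta>, of \<theta> \<alpha>]) (rule that, unfold S_def err_def)
  have pos: "h > 0" if "h \<in> S" for h
    using that by (simp add: S_def SCQ_steps_def)
  have ev: "eventually P (at 0 within S)" if "\<And>h. h \<in> S \<Longrightarrow> h < h0 \<Longrightarrow> h < 1 \<Longrightarrow> P h" for P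
    unfolding eventually_at using that h0 by (intro exI[of _ "min h0 1"]) (auto simp: dist_real_def)
  show "\<exists>e1 e2. e1 \<in> O[at 0 within SCQ_steps \<theta> \<beta> \<delta>](\<lambda>h. complex_of_real h powr \<beta>) \<and>
                e2 \<in> O[at 0 within SCQ_steps \<theta> \<beta> \<delta>](\<lambda>h. complex_of_real h ^ p) \<and>
                (\<forall>h\<in>SCQ_steps \<theta> \<beta> \<delta>. SCQ_error_power (fps_nth (SCQ_generating \<alpha> \<theta> p)) \<alpha> \<theta> h \<beta> 1 = e1 h + e2 h)"
    unfolding S_def [symmetric]
  \<comment> \<open>For h < 1 the smaller of the exponents Re \<beta> and p dominates, so the whole
    error is put into that one summand and the other is zero. The equation then holds for every
    admissible h, although the bound is only for small h.\<close>
  proof (cases "Re \<beta> \<le> real p")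
    case True
    have "err \<in> O[at 0 within S](\<lambda>h. complex_of_real h powr \<beta>)"
    proof (rule bigoI[of _ "C * 2"], rule ev)
      fix h assume h: "h \<in> S" "h < h0" "h < 1"
      have "h ^ p \<le> h powr Re \<beta>"
        using pos[OF h(1)] h(3) True powr_mono'[of "Re \<beta>" "real p" h] by (simp add: powr_realpow)
      then have "h powr Re \<beta> + h ^ p \<le> 2 * h powr Re \<beta>" by simp
      from order_trans[OF bound[OF h(1,2)] mult_left_mono[OF this]]
      show "norm (err h) \<le> C * 2 * norm (complex_of_real h powr \<beta>)"
        using C pos[OF h(1)] by (simp add: norm_of_real_powr mult.assoc)
    qed
    then show "\<exists>e1 e2. e1 \<in> O[at 0 within S](\<lambda>h. complex_of_real h powr \<beta>) \<and>
                e2 \<in> O[at 0 within S](\<lambda>h. complex_of_real h ^ p) \<and>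
                (\<forall>h\<in>S. SCQ_error_power (fps_nth (SCQ_generating \<alpha> \<theta> p)) \<alpha> \<theta> h \<beta> 1 = e1 h + e2 h)"
      by (intro exI[of _ err] exI[of _ "\<lambda>_. 0"]) (simp add: err_def)
  next
    case False
    have "err \<in> O[at 0 within S](\<lambda>h. complex_of_real h ^ p)"
    proof (rule bigoI[of _ "C * 2"], rule ev)
      fix h assume h: "h \<in> S" "h < h0" "h < 1"
      have "h powr Re \<beta> \<le> h ^ p"
        using pos[OF h(1)] h(3) False powr_mono'[of "real p" "Re \<beta>" h] by (simp add: powr_realpow)
      then have "h powr Re \<beta> + h ^ p \<le> 2 * h ^ p" by simp
      from order_trans[OF bound[OF h(1,2)] mult_left_mono[OF this]]
      show "norm (err h) \<le> C * 2 * norm (complex_of_real h ^ p)"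
        using C pos[OF h(1)] by (simp add: norm_power mult.assoc)
    qed
    then show "\<exists>e1 e2. e1 \<in> O[at 0 within S](\<lambda>h. complex_of_real h powr \<beta>) \<and>
                e2 \<in> O[at 0 within S](\<lambda>h. complex_of_real h ^ p) \<and>
                (\<forall>h\<in>S. SCQ_error_power (fps_nth (SCQ_generating \<alpha> \<theta> p)) \<alpha> \<theta> h \<beta> 1 = e1 h + e2 h)"
      by (intro exI[of _ "\<lambda>_. 0"] exI[of _ err]) (simp add: err_def)
  qed
qed

end
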